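(* Let $X$ be a quasi-normed lattice of function sequences and $s\in(0,\infty)$, and assume the regularity $L$ of the Daubechies wavelet system satisfies $L>s$. Then, for any $f\in\Lambda_s$, $$\mathrm{dist}\left(f,\Lambda^s_X\right)_{\Lambda_s}\sim\inf\left\{\varepsilon\in(0,\infty):\left\|\left\{\sum_{I\in W^0_j(s,f,\varepsilon)}\mathbf 1_I\right\}_{j\in\mathbb Z_+}\right\|_X<\infty\right\}$$ with positive equivalence constants independent of $f$, where $W_j^0(s,f,\varepsilon):=\{I\in\mathcal D_j:\max_{\omega\in\Omega:I_\omega=I}|\langle f,\psi_\omega\rangle|>\varepsilon|I|^{s/n+1/2}\}$.
   Context: $\Delta_hf(x):=f(x+h/2)-f(x-h/2)$, $\Delta_h^{k+1}:=\Delta_h^k\Delta_h$, $\Delta_kf(x,y):=\sup_{|h|=y}|\Delta_h^kf(x)|$. $\Lambda_s$ ($s>0$): bounded continuous $f$ with $\|f\|_{\Lambda_s}:=\|f\|_{L^\infty}+\sup_{x\in\mathbb R^n,y\in(0,1]}\Delta_{\lfloor s\rfloor+1}f(x,y)/y^s<\infty$; $\mathrm{dist}(f,V)_{\Lambda_s}:=\inf_{g\in V\cap\Lambda_s}\|f-g\|_{\Lambda_s}$. $\mathcal D_j=\{2^{-j}(k+[0,1)^n):k\in\mathbb Z^n\}$, $\mathcal D=\bigcup_{j\in\mathbb Z_+}\mathcal D_j$. Daubechies wavelet system of regularity $L$: $\varphi,\psi_\ell\in C^L_c(\mathbb R^n)$ ($\ell=1,\dots,2^n-1$), each $\psi_\ell$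 orthogonal to all polynomials of degree $\le L$, with $\{\varphi(\cdot-k)\}_{k}\cup\{2^{jn/2}\psi_\ell(2^j\cdot-k)\}_{\ell,j\ge0,k}$ an orthonormal basis of $L^2$; indexed by $\Omega=\{0\}\times\mathcal D_0\cup\{1,\dots,2^n-1\}\times\mathcal D$ via $\psi_{(0,k+[0,1)^n)}=\varphi(\cdot-k)$, $\psi_{(\ell,2^{-j}(k+[0,1)^n))}=2^{jn/2}\psi_\ell(2^j\cdot-k)$, with $I_{(\ell,I)}:=I$; $\langle f,\psi_\omega\rangle=\int f\psi_\omega$. A quasi-normed lattice of function sequences is a $[0,\infty]$-valued quasi-norm $\|\cdot\|_X$ on sequences $\{f_j\}_{j\in\mathbb Z_+}$ of a.e. finite measurable functions on $\mathbb R^n$, monotone with respect to pointwise a.e. domination of absolute values, with the left and right shifts bounded ($\|\{f_{j+1}\}\|_X+\|\{f_{j-1}\}\|_X\le C\|\{f_j\}\|_X$, $f_{-1}:=0$), and with $\|\{f,0,0,\dots\}\|_X<\infty$ for bounded compactly supported $f$. The Daubechies $s$-Lipschitz $X$-based space $\Lambda^s_X$ is the set of $f\in\Lambda_s$ with $\|\{\sum_{\omega:I_\omega\in\mathcal D_j}|I_\omega|^{-s/n-1/2}|\langle f,\psi_\omega\rangle|\mathbf 1_{I_\omega}\}_{j\in\mathbb Z_+}\|_X<\infty$. *)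

theory Defs
  imports "HOL-Analysis.Analysis"
begin

definition diff1 :: "real^'n \<Rightarrow> (real^'n \<Rightarrow> real) \<Rightarrow> (real^'n \<Rightarrow> real)" where
  "diff1 h f = (\<lambda>x. f (x + (1/2) *\<^sub>R h) - f (x - (1/2) *\<^sub>R h))"

definition diffk :: "nat \<Rightarrow> real^'n \<Rightarrow> (real^'n \<Rightarrow> real) \<Rightarrow> (real^'n \<Rightarrow> real)" where
  "diffk k h f = (diff1 h ^^ k) f"

definition Delta_sup :: "nat \<Rightarrow> (real^'n \<Rightarrow> real) \<Rightarrow> real^'n \<Rightarrow> real \<Rightarrow> ennreal" where
  "Delta_sup k f x y = (SUP h\<in>{h. norm h = y}. ennreal \<bar>diffk k h f x\<bar>)"

text \<open>L^infinity norm (for the continuous functions considered here, the pointwise sup).\<close>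
definition sup_norm :: "(real^'n \<Rightarrow> real) \<Rightarrow> ennreal" where
  "sup_norm f = (SUP x. ennreal \<bar>f x\<bar>)"

definition Lambda_norm :: "real \<Rightarrow> (real^'n \<Rightarrow> real) \<Rightarrow> ennreal" where
  "Lambda_norm s f = sup_norm f +
     (SUP x. SUP y\<in>{0<..1}. Delta_sup (nat \<lfloor>s\<rfloor> + 1) f x y / ennreal (y powr s))"

definition Lambda :: "real \<Rightarrow> (real^'n \<Rightarrow> real) set" where
  "Lambda s = {f. continuous_on UNIV f \<and> bounded (range f) \<and> Lambda_norm s f < \<infinity>}"

definition dist_Lambda :: "real \<Rightarrow> (real^'n \<Rightarrow> real) \<Rightarrow> (real^'n \<Rightarrow> real) set \<Rightarrow> ennreal" where
  "dist_Lambda s f V = (INF g\<in>V \<inter> Lambda s. Lambda_norm s (\<lambda>x. f x - g x))"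

definition ivec :: "int^'n \<Rightarrow> real^'n" where
  "ivec k = (\<chi> i. real_of_int (k $ i))"

definition dcube :: "nat \<Rightarrow> int^'n \<Rightarrow> (real^'n) set" where
  "dcube j k = {x. \<forall>i. real_of_int (k $ i) / 2 ^ j \<le> x $ i \<and> x $ i < (real_of_int (k $ i) + 1) / 2 ^ j}"

definition cube_vol :: "nat \<Rightarrow> int^'n \<Rightarrow> real" where
  "cube_vol j k = measure lborel (dcube j k)"

fun Ck :: "nat \<Rightarrow> (real^'n \<Rightarrow> real) \<Rightarrow> bool" where
  "Ck 0 f = continuous_on UNIV f"
| "Ck (Suc k) f = (f differentiable_on UNIV \<and>
      (\<forall>i. Ck k (\<lambda>x. frechet_derivative f (at x) (axis i 1))))"

definition Ck_c :: "nat \<Rightarrow> (real^'n \<Rightarrow> real) \<Rightarrow> bool" where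
  "Ck_c k f \<longleftrightarrow> Ck k f \<and> compact (closure {x. f x \<noteq> 0})"

text \<open>Index set Omega: (0,0,k) stands for (0, k+[0,1)^n) and (l,j,k), 1 <= l <= 2^n-1,
  stands for (l, 2^{-j}(k+[0,1)^n)).\<close>
definition Omega :: "(nat \<times> nat \<times> (int^'n)) set" where
  "Omega = {(l, j, k). (l = 0 \<and> j = 0) \<or> (1 \<le> l \<and> l \<le> 2 ^ CARD('n) - 1)}"

definition wav :: "(real^'n \<Rightarrow> real) \<Rightarrow> (nat \<Rightarrow> real^'n \<Rightarrow> real)
                   \<Rightarrow> nat \<times> nat \<times> (int^'n) \<Rightarrow> real^'n \<Rightarrow> real" where
  "wav \<phi> \<psi> \<omega> x = (case \<omega> of (l, j, k) \<Rightarrow>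
      if l = 0 then \<phi> (x - ivec k)
      else 2 powr (real j * real CARD('n) / 2) * \<psi> l ((2 ^ j) *\<^sub>R x - ivec k))"

definition daubechies :: "nat \<Rightarrow> (real^'n \<Rightarrow> real) \<Rightarrow> (nat \<Rightarrow> real^'n \<Rightarrow> real) \<Rightarrow> bool" where
  "daubechies L \<phi> \<psi> \<longleftrightarrow>
     Ck_c L \<phi> \<and>
     (\<forall>l\<in>{1..2 ^ CARD('n) - 1}. Ck_c L (\<psi> l)) \<and>
     (\<forall>l\<in>{1..2 ^ CARD('n) - 1}. \<forall>\<alpha>::'n \<Rightarrow> nat. (\<Sum>i\<in>UNIV. \<alpha> i) \<le> L \<longrightarrow>
         (LINT x|lborel. \<psi> l x * (\<Prod>i\<in>UNIV. (x $ i) ^ \<alpha> i)) = 0) \<and>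
     (\<forall>\<omega>\<in>Omega. \<forall>\<omega>'\<in>Omega.
         (LINT x|lborel. wav \<phi> \<psi> \<omega> x * wav \<phi> \<psi> \<omega>' x) = (if \<omega> = \<omega>' then 1 else 0)) \<and>
     (\<forall>g\<in>borel_measurable lborel. integrable lborel (\<lambda>x. (g x)\<^sup>2) \<longrightarrow>
         (\<forall>\<omega>\<in>Omega. (LINT x|lborel. g x * wav \<phi> \<psi> \<omega> x) = 0) \<longrightarrow>
         (AE x in lborel. g x = 0))"

definition coef :: "(real^'n \<Rightarrow> real) \<Rightarrow> (nat \<Rightarrow> real^'n \<Rightarrow> real)
                    \<Rightarrow> (real^'n \<Rightarrow> real) \<Rightarrow> nat \<times> nat \<times> (int^'n) \<Rightarrow> real" where
  "coef \<phi> \<psi> f \<omega> = (LINT x|lborel. f x * wav \<phi> \<psi> \<omega> x)"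

definition adm_seq :: "(nat \<Rightarrow> real^'n \<Rightarrow> real) \<Rightarrow> bool" where
  "adm_seq F \<longleftrightarrow> (\<forall>j. F j \<in> borel_measurable lebesgue)"

definition qn_lattice :: "((nat \<Rightarrow> real^'n \<Rightarrow> real) \<Rightarrow> ennreal) \<Rightarrow> bool" where
  "qn_lattice X \<longleftrightarrow>
     (\<forall>F. adm_seq F \<longrightarrow> (X F = 0 \<longleftrightarrow> (\<forall>j. AE x in lebesgue. F j x = 0))) \<and>
     (\<forall>F c. adm_seq F \<longrightarrow> X (\<lambda>j x. c * F j x) = ennreal \<bar>c\<bar> * X F) \<and>
     (\<exists>K\<ge>1. \<forall>F G. adm_seq F \<longrightarrow> adm_seq G \<longrightarrow>
         X (\<lambda>j x. F j x + G j x) \<le> ennreal K * (X F + X G)) \<and>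
     (\<forall>F G. adm_seq F \<longrightarrow> adm_seq G \<longrightarrow> (\<forall>j. AE x in lebesgue. \<bar>F j x\<bar> \<le> \<bar>G j x\<bar>)
         \<longrightarrow> X F \<le> X G) \<and>
     (\<exists>C. \<forall>F. adm_seq F \<longrightarrow>
         X (\<lambda>j. F (Suc j)) + X (\<lambda>j. if j = 0 then (\<lambda>x. 0) else F (j - 1)) \<le> ennreal C * X F) \<and>
     (\<forall>f. f \<in> borel_measurable lebesgue \<longrightarrow> bounded (range f) \<longrightarrow> bounded {x. f x \<noteq> 0} \<longrightarrow>
         X (\<lambda>j. if j = 0 then f else (\<lambda>x. 0)) < \<infinity>)"

definition wseq :: "real \<Rightarrow> (real^'n \<Rightarrow> real) \<Rightarrow> (nat \<Rightarrow> real^'n \<Rightarrow> real)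
                    \<Rightarrow> (real^'n \<Rightarrow> real) \<Rightarrow> nat \<Rightarrow> real^'n \<Rightarrow> real" where
  "wseq s \<phi> \<psi> f j x = (\<Sum>\<^sub>\<infinity>\<omega>\<in>{\<omega>\<in>Omega. fst (snd \<omega>) = j}.
      cube_vol j (snd (snd \<omega>)) powr (- s / real CARD('n) - 1/2) * \<bar>coef \<phi> \<psi> f \<omega>\<bar>
      * indicator (dcube j (snd (snd \<omega>))) x)"

definition Lambda_X :: "((nat \<Rightarrow> real^'n \<Rightarrow> real) \<Rightarrow> ennreal) \<Rightarrow> real \<Rightarrow> (real^'n \<Rightarrow> real)
                       \<Rightarrow> (nat \<Rightarrow> real^'n \<Rightarrow> real) \<Rightarrow> (real^'n \<Rightarrow> real) set" where
  "Lambda_X X s \<phi> \<psi> = {f \<in> Lambda s. X (wseq s \<phi> \<psi> f) < \<infinity>}"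

text \<open>W^0_j(s,f,eps), cubes in D_j represented by their integer label k.\<close>
definition W0 :: "(real^'n \<Rightarrow> real) \<Rightarrow> (nat \<Rightarrow> real^'n \<Rightarrow> real) \<Rightarrow> real
                  \<Rightarrow> (real^'n \<Rightarrow> real) \<Rightarrow> real \<Rightarrow> nat \<Rightarrow> (int^'n) set" where
  "W0 \<phi> \<psi> s f \<epsilon> j = {k. Max {\<bar>coef \<phi> \<psi> f \<omega>\<bar> | \<omega>. \<omega> \<in> Omega \<and> fst (snd \<omega>) = j \<and> snd (snd \<omega>) = k}
      > \<epsilon> * cube_vol j k powr (s / real CARD('n) + 1/2)}"

definition W0_seq :: "(real^'n \<Rightarrow> real) \<Rightarrow> (nat \<Rightarrow> real^'n \<Rightarrow> real) \<Rightarrow> real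
                  \<Rightarrow> (real^'n \<Rightarrow> real) \<Rightarrow> real \<Rightarrow> nat \<Rightarrow> real^'n \<Rightarrow> real" where
  "W0_seq \<phi> \<psi> s f \<epsilon> j x = (\<Sum>\<^sub>\<infinity>k\<in>W0 \<phi> \<psi> s f \<epsilon> j. indicator (dcube j k) x)"

definition eps_crit :: "((nat \<Rightarrow> real^'n \<Rightarrow> real) \<Rightarrow> ennreal) \<Rightarrow> real \<Rightarrow> (real^'n \<Rightarrow> real)
                       \<Rightarrow> (nat \<Rightarrow> real^'n \<Rightarrow> real) \<Rightarrow> (real^'n \<Rightarrow> real) \<Rightarrow> ennreal" where
  "eps_crit X s \<phi> \<psi> f = Inf {ennreal \<epsilon> | \<epsilon>. 0 < \<epsilon> \<and> X (W0_seq \<phi> \<psi> s f \<epsilon>) < \<infinity>}"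

end

theory Submission
  imports Defs
begin

text \<open>Two facts about the wavelet coefficients \<open>\<langle>f, \<psi>\<^sub>\<omega>\<rangle>\<close> give the result. Analysis: they are
  bounded by \<open>C \<parallel>f\<parallel> |I|\<^bsup>s/n+1/2\<^esup>\<close>. Synthesis: every coefficient family bounded by \<open>\<epsilon> |I|\<^bsup>s/n+1/2\<^esup>\<close> is that of a function of norm at most \<open>C \<epsilon>\<close>.
  If \<open>g\<close> lies in the \<open>X\<close>-based space and \<open>\<epsilon> > C \<parallel>f - g\<parallel>\<close>, analysis applied to \<open>f - g\<close> shows that the
  normalised coefficients of \<open>g\<close> stay away from \<open>0\<close> on the cubes of \<open>W\<^sup>0(s, f, \<epsilon>)\<close>, so the indicator
  sequence of these cubes has finite \<open>X\<close>-norm. Conversely, synthesising the coefficients of \<open>f\<close> off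
  \<open>W\<^sup>0(s, f, \<epsilon>)\<close> gives \<open>h\<close> with \<open>\<parallel>h\<parallel> \<le> C \<epsilon>\<close>, and \<open>f - h\<close> lies in the \<open>X\<close>-based space.

  Synthesis is the usual summation over dyadic scales. Analysis avoids Whitney's theorem on local polynomial
  approximation: \<open>\<phi>\<^sup>2\<close> is a \<open>C\<^sup>L\<close> mollifier of integral \<open>1\<close>, and suitable combinations of its dilates
  reproduce \<open>f\<close> up to an \<open>m\<close>-th difference.\<close>

section \<open>Functions of class C^k and finite differences\<close>

text \<open>The obstacle sits in the analysis bound. Vanishing moments annihilate polynomials,
  whereas membership in \<open>Lambda\<close> only controls differences of order
  \<open>m = diff_order s\<close>, so the moments need something differentiable to act on. They are
  made to act on the mollifier: its derivatives of order \<open>m\<close> gain a factor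
  \<open>2^-m\<close> per dyadic scale, the differences of \<open>f\<close> gain
  \<open>2^-s\<close>, and \<open>s < m\<close> makes the sum over scales geometric. The same
  competition between \<open>2^-m\<close> and \<open>2^-s\<close> decides synthesis. Since
  \<open>m\<close> is the integer part of \<open>s\<close> plus one, \<open>s < L\<close> yields
  \<open>m \<le> L\<close>; thus smoothness and moments of the generators reach order
  \<open>m\<close>. In the upper estimate the competitor is obtained by subtraction,
  \<open>g = f - h\<close>: its distance to \<open>f\<close> is the norm of \<open>h\<close>, and
  its coefficients follow by linearity. The lattice \<open>X\<close> enters only through finiteness.
  The constants of its domination arguments may therefore depend on \<open>f\<close> and on the
  threshold, while the equivalence constants come from analysis and synthesis alone.\<close>

abbreviation partial :: "'n \<Rightarrow> (real^'n \<Rightarrow> real) \<Rightarrow> real^'n \<Rightarrow> real" where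
  "partial i f \<equiv> \<lambda>x. frechet_derivative f (at x) (axis i 1)"

lemma partial_eqI: "(f has_derivative D) (at x) \<Longrightarrow> partial i f x = D (axis i 1)"
  using frechet_derivative_at[of f D x] by simp

lemma differentiable_on_UNIV_has_derivative:
  "f differentiable_on UNIV \<Longrightarrow> (f has_derivative frechet_derivative f (at x)) (at x)"
  by (simp add: differentiable_on_def frechet_derivative_works)

lemma Ck_SucD: "Ck (Suc k) f \<Longrightarrow> Ck k f"
proof (induction k arbitrary: f)
  case 0
  then show ?case by (simp add: differentiable_imp_continuous_on)
next
  case (Suc k)
  from Suc.prems have *: "f differentiable_on UNIV \<and> (\<forall>i. Ck (Suc k) (partial i f))"
    by (subst (asm) Ck.simps(2))
  show ?case by (subst Ck.simps(2)) (use * Suc.IH in blast)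
qed

lemma Ck_antimono: "k \<le> L \<Longrightarrow> Ck L f \<Longrightarrow> Ck k f"
  by (induction L rule: dec_induct) (auto dest: Ck_SucD simp del: Ck.simps)

lemma Ck_imp_continuous: "Ck k f \<Longrightarrow> continuous_on UNIV f"
  using Ck_antimono[of 0 k f] by simp

lemma Ck_add: "Ck k f \<Longrightarrow> Ck k g \<Longrightarrow> Ck k (\<lambda>x. f x + g x)"
proof (induction k arbitrary: f g)
  case 0
  then show ?case by (simp add: continuous_on_add)
next
  case (Suc k)
  have d: "f differentiable_on UNIV" "g differentiable_on UNIV" using Suc.prems by simp_all
  have "partial i (\<lambda>x. f x + g x) = (\<lambda>x. partial i f x + partial i g x)" for i
    by (rule ext, rule partial_eqI, intro has_derivative_add)
      (use d differentiable_on_UNIV_has_derivative in auto)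
  with Suc d show ?case by (simp add: differentiable_on_add)
qed

lemma Ck_mult: "Ck k f \<Longrightarrow> Ck k g \<Longrightarrow> Ck k (\<lambda>x. f x * g x)"
proof (induction k arbitrary: f g)
  case 0
  then show ?case by (simp add: continuous_on_mult)
next
  case (Suc k)
  have d: "f differentiable_on UNIV" "g differentiable_on UNIV" using Suc.prems by simp_all
  have e: "partial i (\<lambda>x. f x * g x) = (\<lambda>x. f x * partial i g x + partial i f x * g x)" for i
    by (rule ext, rule partial_eqI, intro has_derivative_mult)
      (use d differentiable_on_UNIV_has_derivative in auto)
  have k: "Ck k f" "Ck k g" using Suc.prems Ck_SucD by blast+
  have "(\<lambda>x. f x * g x) differentiable_on UNIV"
    using d by (simp add: differentiable_on_def)
  moreover have "Ck k (\<lambda>x. f x * partial i g x + partial i f x * g x)" for i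
    using Suc k by (intro Ck_add Suc.IH) auto
  ultimately show ?case by (simp add: e)
qed

lemma frechet_derivative_eq_sum_partial:
  assumes "f differentiable (at x)"
  shows "frechet_derivative f (at x) v = (\<Sum>i\<in>UNIV. v $ i * partial i f x)"
proof -
  have l: "linear (frechet_derivative f (at x))"
    by (rule linear_frechet_derivative[OF assms])
  have "frechet_derivative f (at x) v = frechet_derivative f (at x) (\<Sum>i\<in>UNIV. v $ i *\<^sub>R axis i 1)"
    using basis_expansion[of v] by (simp add: scalar_mult_eq_scaleR)
  also have "\<dots> = (\<Sum>i\<in>UNIV. v $ i * partial i f x)"
    by (simp add: linear_sum[OF l] linear_cmul[OF l])
  finally show ?thesis .
qed

lemma has_real_derivative_along_line:
  fixes f :: "real^'n \<Rightarrow> real"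
  assumes "f differentiable_on UNIV"
  shows "((\<lambda>t. f (a + t *\<^sub>R v)) has_real_derivative (\<Sum>i\<in>UNIV. v $ i * partial i f (a + t *\<^sub>R v))) (at t)"
proof -
  let ?D = "frechet_derivative f (at (a + t *\<^sub>R v))"
  have d: "f differentiable (at (a + t *\<^sub>R v))" using assms by (simp add: differentiable_on_def)
  have 1: "((\<lambda>t. a + t *\<^sub>R v) has_derivative (\<lambda>u. u *\<^sub>R v)) (at t)"
    by (auto intro!: derivative_eq_intros)
  have "((\<lambda>t. f (a + t *\<^sub>R v)) has_derivative (\<lambda>u. ?D (u *\<^sub>R v))) (at t)"
    using has_derivative_compose[OF 1, of f ?D] d frechet_derivative_works by blast
  moreover have "?D (u *\<^sub>R v) = (\<Sum>i\<in>UNIV. v $ i * partial i f (a + t *\<^sub>R v)) * u" for u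
    by (subst frechet_derivative_eq_sum_partial[OF d]) (simp add: sum_distrib_left sum_distrib_right mult_ac)
  ultimately show ?thesis unfolding has_field_derivative_def by simp
qed

text \<open>Only the partial derivatives of order exactly \<open>k\<close> are bounded; they are
  what a Taylor remainder or a difference of order \<open>k\<close> sees.\<close>

fun Ck_bound :: "nat \<Rightarrow> real \<Rightarrow> (real^'n \<Rightarrow> real) \<Rightarrow> bool" where
  "Ck_bound 0 M f = (\<forall>x. \<bar>f x\<bar> \<le> M)"
| "Ck_bound (Suc k) M f = (\<forall>i. Ck_bound k M (partial i f))"

lemma Ck_bound_mono: "Ck_bound k M f \<Longrightarrow> M \<le> M' \<Longrightarrow> Ck_bound k M' f"
  by (induction k arbitrary: f) (auto intro: order_trans)

lemma partial_eq_0_outside: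
  assumes "\<And>x. R < norm x \<Longrightarrow> f x = 0" "R < norm x"
  shows "partial i f x = 0"
proof -
  have "((\<lambda>_. 0) has_derivative (\<lambda>_. 0)) (at x)" by simp
  moreover have "open {x::real^'n. R < norm x}"
    by (intro open_Collect_less continuous_intros)
  ultimately have "(f has_derivative (\<lambda>_. 0)) (at x)"
    by (rule has_derivative_transform_within_open) (use assms in auto)
  from partial_eqI[OF this] show ?thesis by simp
qed

lemma bounded_if_compact_support:
  fixes f :: "real^'n \<Rightarrow> real"
  assumes "continuous_on UNIV f" "\<And>x. R < norm x \<Longrightarrow> f x = 0"
  shows "\<exists>M\<ge>0. \<forall>x. \<bar>f x\<bar> \<le> M"
proof -
  have "compact (f ` cball 0 R)"
    by (rule compact_continuous_image) (use continuous_on_subset[OF assms(1)] in auto)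
  then obtain M where M: "\<forall>y\<in>f ` cball 0 R. norm y \<le> M"
    using compact_imp_bounded bounded_iff by blast
  have "\<bar>f x\<bar> \<le> max M 0" for x
    using M assms(2)[of x] by (cases "norm x \<le> R") (auto intro: max.coboundedI1)
  then show ?thesis by (intro exI[of _ "max M 0"]) auto
qed

lemma ex_uniform_bound:
  fixes P :: "'a::finite \<Rightarrow> real \<Rightarrow> bool"
  assumes "\<And>i. \<exists>M. P i M" "\<And>i M M'. P i M \<Longrightarrow> M \<le> M' \<Longrightarrow> P i M'"
  shows "\<exists>M. \<forall>i. P i M"
proof -
  obtain M where M: "\<And>i. P i (M i)" using assms(1) by metis
  have "P i (Max (range M))" for i by (rule assms(2)[OF M]) simp
  then show ?thesis by blast
qed

lemma Ck_bound_if_compact_support: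
  fixes f :: "real^'n \<Rightarrow> real"
  assumes "Ck k f" "\<And>x. R < norm x \<Longrightarrow> f x = 0"
  shows "\<exists>M. Ck_bound k M f"
  using assms
proof (induction k arbitrary: f)
  case 0
  then show ?case using bounded_if_compact_support[of f R] by auto
next
  case (Suc k)
  have "\<exists>M. Ck_bound k M (partial i f)" for i
    by (rule Suc.IH) (use Suc.prems partial_eq_0_outside[of R f] in auto)
  from ex_uniform_bound[of "\<lambda>i M. Ck_bound k M (partial i f)", OF this Ck_bound_mono]
  show ?case by simp
qed

text \<open>The \<open>k\<close>-th directional derivative of \<open>f\<close> at \<open>x\<close> along \<open>v\<close>, in a form that shows it to be a
  homogeneous polynomial in \<open>v\<close>.\<close>
fun dir_deriv :: "nat \<Rightarrow> (real^'n \<Rightarrow> real) \<Rightarrow> real^'n \<Rightarrow> real^'n \<Rightarrow> real" where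
  "dir_deriv 0 f v x = f x"
| "dir_deriv (Suc k) f v x = (\<Sum>i\<in>UNIV. v $ i * dir_deriv k (partial i f) v x)"

lemma dir_deriv_along_line:
  "Ck (Suc k) f \<Longrightarrow>
   ((\<lambda>t. dir_deriv k f v (a + t *\<^sub>R v)) has_real_derivative dir_deriv (Suc k) f v (a + t *\<^sub>R v)) (at t)"
proof (induction k arbitrary: f)
  case 0
  then show ?case using has_real_derivative_along_line[of f a v t] by simp
next
  case (Suc k)
  then have "Ck (Suc k) (partial i f)" for i by simp
  from Suc.IH[OF this] show ?case
    unfolding dir_deriv.simps(2)[of "Suc k"] dir_deriv.simps(2)[of k f]
    by (intro DERIV_sum DERIV_cmult)
qed

text \<open>Each of the \<open>k\<close> layers sums over the coordinates and contributes a
  component of \<open>v\<close>, at most \<open>norm v\<close>.\<close>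

lemma dir_deriv_bound:
  fixes f :: "real^'n \<Rightarrow> real"
  shows "Ck_bound k M f \<Longrightarrow> \<bar>dir_deriv k f v x\<bar> \<le> M * (real CARD('n) * norm v) ^ k"
proof (induction k arbitrary: f)
  case (Suc k)
  let ?B = "M * (real CARD('n) * norm v) ^ k"
  have "\<bar>v $ i * dir_deriv k (partial i f) v x\<bar> \<le> norm v * ?B" for i
    unfolding abs_mult using Suc by (intro mult_mono component_le_norm_cart) auto
  then have "\<bar>dir_deriv (Suc k) f v x\<bar> \<le> (\<Sum>i\<in>(UNIV::'n set). norm v * ?B)"
    unfolding dir_deriv.simps by (intro order_trans[OF sum_abs] sum_mono)
  then show ?case by (simp add: mult_ac)
qed simp

text \<open>For fixed \<open>x\<close> the expression is a polynomial in \<open>v\<close>. This is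
  what makes the Taylor polynomial integrable against a wavelet when \<open>v\<close> is the
  integration variable.\<close>

lemma continuous_on_dir_deriv: "continuous_on UNIV (\<lambda>v. dir_deriv k f v x)"
  by (induction k arbitrary: f) (auto intro!: continuous_intros)

text \<open>Direction and parameter are kept apart: later the moments are taken over
  \<open>v\<close>, while \<open>t\<close> is a fixed ratio of scales. The \<open>k\<close>-th
  Taylor term is then homogeneous of degree \<open>k\<close> in the integration variable.\<close>

lemma taylor_along_line:
  fixes f :: "real^'n \<Rightarrow> real"
  assumes "Ck m f" "Ck_bound m M f"
  shows "\<bar>f (a + t *\<^sub>R v) - (\<Sum>k<m. dir_deriv k f v a / fact k * t ^ k)\<bar>
          \<le> M * (real CARD('n) * norm v * \<bar>t\<bar>) ^ m"
proof -
  have D: "DERIV (\<lambda>t. dir_deriv k f v (a + t *\<^sub>R v)) u :> dir_deriv (Suc k) f v (a + u *\<^sub>R v)"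
    if "k < m" for k u
    using dir_deriv_along_line Ck_antimono[OF _ assms(1)] that by (metis Suc_leI)
  \<comment> \<open>The two-sided form of the remainder is required, because \<open>t\<close> will
    be \<open>-\<delta>\<close> with \<open>\<delta> \<ge> 0\<close>.\<close>
  obtain u where u: "f (a + t *\<^sub>R v) = (\<Sum>k<m. dir_deriv k f v (a + 0 *\<^sub>R v) / fact k * t ^ k)
      + dir_deriv m f v (a + u *\<^sub>R v) / fact m * t ^ m"
    using Maclaurin_bi_le[of "\<lambda>k t. dir_deriv k f v (a + t *\<^sub>R v)" "\<lambda>t. f (a + t *\<^sub>R v)" m t] D by auto
  let ?d = "dir_deriv m f v (a + u *\<^sub>R v)"
  have "\<bar>?d\<bar> / fact m \<le> \<bar>?d\<bar> / 1" by (rule divide_left_mono) (auto simp: fact_ge_1)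
  also have "\<dots> \<le> M * (real CARD('n) * norm v) ^ m" using dir_deriv_bound[OF assms(2)] by simp
  finally have "\<bar>?d\<bar> / fact m * \<bar>t\<bar> ^ m \<le> M * (real CARD('n) * norm v) ^ m * \<bar>t\<bar> ^ m"
    by (rule mult_right_mono) simp
  with u show ?thesis by (simp add: abs_mult power_abs power_mult_distrib mult_ac)
qed

section \<open>Central differences of order k\<close>

lemma diffk_Suc: "diffk (Suc k) h f x = diffk k h f (x + (1/2) *\<^sub>R h) - diffk k h f (x - (1/2) *\<^sub>R h)"
  by (simp add: diffk_def diff1_def)

lemma diffk_0 [simp]: "diffk 0 h f = f"
  by (simp add: diffk_def)

lemma diffk_bound_sup:
  "(\<And>x. \<bar>f x\<bar> \<le> M) \<Longrightarrow> \<bar>diffk k h f x\<bar> \<le> 2 ^ k * M"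
proof (induction k arbitrary: x)
  case (Suc k)
  have "\<bar>diffk (Suc k) h f x\<bar> \<le> 2 ^ k * M + 2 ^ k * M"
    unfolding diffk_Suc using Suc.IH[OF Suc.prems] by (intro order_trans[OF abs_triangle_ineq4] add_mono)
  then show ?case by (simp add: mult_ac)
qed simp

lemma diffk_differentiable:
  "f differentiable_on UNIV \<Longrightarrow> diffk k h f differentiable_on UNIV \<and>
     partial i (diffk k h f) = diffk k h (partial i f)"
proof (induction k)
  case (Suc k)
  let ?g = "diffk k h f"
  have *: "((\<lambda>x. ?g (x + a) - ?g (x - a)) has_derivative
      (\<lambda>v. frechet_derivative ?g (at (x + a)) v - frechet_derivative ?g (at (x - a)) v)) (at x)" for x a
  proof -
    have "((\<lambda>x. ?g (x + b)) has_derivative frechet_derivative ?g (at (x + b))) (at x)" for b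
    proof -
      have "((\<lambda>x. x + b) has_derivative (\<lambda>v. v)) (at x)" by (auto intro!: derivative_eq_intros)
      then show ?thesis using has_derivative_compose[of "\<lambda>x. x + b" "\<lambda>v. v" x UNIV ?g "frechet_derivative ?g (at (x + b))"]
        differentiable_on_UNIV_has_derivative[of ?g "x + b"] Suc
        by blast
    qed
    from this[of a] this[of "-a"] show ?thesis by (auto intro: has_derivative_diff)
  qed
  have e: "diffk (Suc k) h f = (\<lambda>x. ?g (x + (1/2) *\<^sub>R h) - ?g (x - (1/2) *\<^sub>R h))"
    by (rule ext) (rule diffk_Suc)
  have "diffk (Suc k) h f differentiable_on UNIV"
    unfolding e differentiable_on_def differentiable_def using * by blast
  moreover have "partial i (diffk (Suc k) h f) = diffk (Suc k) h (partial i f)"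
    unfolding e using partial_eqI[OF *, where ?a1 = "(1/2) *\<^sub>R h"] Suc
    by (auto simp: diffk_Suc fun_eq_iff)
  ultimately show ?case by blast
qed simp

text \<open>The mean value theorem on the segment from \<open>x - h/2\<close> to
  \<open>x + h/2\<close> trades one difference for one partial derivative. Partial derivatives
  commute with differences, so the induction hypothesis applies to
  \<open>partial i f\<close>.\<close>

lemma diffk_bound_Ck:
  fixes f :: "real^'n \<Rightarrow> real"
  shows "Ck k f \<Longrightarrow> Ck_bound k M f \<Longrightarrow> \<bar>diffk k h f x\<bar> \<le> M * (real CARD('n) * norm h) ^ k"
proof (induction k arbitrary: f x)
  case (Suc k)
  let ?g = "diffk k h f" and ?B = "M * (real CARD('n) * norm h) ^ k"
  have d: "?g differentiable_on UNIV" "\<And>i. partial i ?g = diffk k h (partial i f)"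
    using diffk_differentiable Suc.prems by auto
  let ?u = "x - (1/2) *\<^sub>R h"
  have "\<exists>z>0. z < 1 \<and> ?g (?u + 1 *\<^sub>R h) - ?g (?u + 0 *\<^sub>R h)
      = (1 - 0) * (\<Sum>i\<in>UNIV. h $ i * partial i ?g (?u + z *\<^sub>R h))"
    by (rule MVT2) (use has_real_derivative_along_line[OF d(1)] in auto)
  then obtain z where z: "?g (?u + 1 *\<^sub>R h) - ?g (?u + 0 *\<^sub>R h)
      = (\<Sum>i\<in>UNIV. h $ i * partial i ?g (?u + z *\<^sub>R h))" by auto
  have "x - (1/2) *\<^sub>R h + h = x + (1/2) *\<^sub>R h"
    by (simp add: vec_eq_iff)
  with z have e: "diffk (Suc k) h f x = (\<Sum>i\<in>UNIV. h $ i * diffk k h (partial i f) (?u + z *\<^sub>R h))"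
    unfolding diffk_Suc by (simp add: fun_cong[OF d(2)])
  have "\<bar>h $ i * diffk k h (partial i f) (?u + z *\<^sub>R h)\<bar> \<le> norm h * ?B" for i
    unfolding abs_mult using Suc by (intro mult_mono component_le_norm_cart Suc.IH) auto
  then have "\<bar>diffk (Suc k) h f x\<bar> \<le> (\<Sum>i\<in>(UNIV::'n set). norm h * ?B)"
    unfolding e by (intro order_trans[OF sum_abs] sum_mono)
  then show ?case by (simp add: mult_ac)
qed simp

lemma diffk_expand:
  "diffk k h f x = (\<Sum>r\<le>k. (-1) ^ (k + r) * real (k choose r) * f (x + (real r - real k / 2) *\<^sub>R h))"
proof (induction k arbitrary: x)
  case (Suc k)
  define F where "F r = f (x + (real r - real (Suc k) / 2) *\<^sub>R h)" for r
  have 1: "x + (1/2) *\<^sub>R h + (real r - real k / 2) *\<^sub>R h = x + (real (Suc r) - real (Suc k) / 2) *\<^sub>R h" for r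
    unfolding add.assoc scaleR_left_distrib[symmetric] by (simp add: field_simps)
  have 2: "x - (1/2) *\<^sub>R h + (real r - real k / 2) *\<^sub>R h = x + (real r - real (Suc k) / 2) *\<^sub>R h" for r
  proof -
    have "x - (1/2) *\<^sub>R h + (real r - real k / 2) *\<^sub>R h = x + (- (1/2) + (real r - real k / 2)) *\<^sub>R h"
      by (simp only: scaleR_left_distrib scaleR_minus_left) simp
    then show ?thesis by (simp add: field_simps)
  qed
  have "diffk (Suc k) h f x = (\<Sum>r\<le>k. (-1) ^ (k + r) * real (k choose r) * F (Suc r))
      - (\<Sum>r\<le>k. (-1) ^ (k + r) * real (k choose r) * F r)"
    unfolding diffk_Suc Suc.IH 1 2 F_def ..
  \<comment> \<open>The added term vanishes since \<open>k choose Suc k = 0\<close>. It aligns the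
    two index ranges, after which Pascal's rule merges the sums.\<close>
  also have "(\<Sum>r\<le>k. (-1) ^ (k + r) * real (k choose r) * F r)
      = (\<Sum>r\<le>Suc k. (-1) ^ (k + r) * real (k choose r) * F r)" by simp
  also have "\<dots> = (-1) ^ k * F 0 + (\<Sum>r\<le>k. (-1) ^ (k + Suc r) * real (k choose Suc r) * F (Suc r))"
    by (subst sum.atMost_Suc_shift) simp
  also have "(\<Sum>r\<le>k. (-1) ^ (k + r) * real (k choose r) * F (Suc r)) -
      ((-1) ^ k * F 0 + (\<Sum>r\<le>k. (-1) ^ (k + Suc r) * real (k choose Suc r) * F (Suc r)))
      = (-1) ^ (Suc k) * F 0 + (\<Sum>r\<le>k. (-1) ^ (Suc k + Suc r) * real (Suc k choose Suc r) * F (Suc r))"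
    by (simp add: sum.distrib algebra_simps sum_negf)
  also have "\<dots> = (\<Sum>r\<le>Suc k. (-1) ^ (Suc k + r) * real (Suc k choose r) * F r)"
    by (subst sum.atMost_Suc_shift) simp
  finally show ?case unfolding F_def .
qed simp

section \<open>Integration and vanishing moments\<close>

lemma lborel_integral_affine:
  fixes F :: "'a::euclidean_space \<Rightarrow> real"
  assumes [measurable]: "F \<in> borel_measurable borel" and "c \<noteq> 0"
  shows "(LINT x|lborel. F x) = \<bar>c\<bar> ^ DIM('a) * (LINT x|lborel. F (t + c *\<^sub>R x))"
  by (subst lborel_affine[OF assms(2), of t])
    (simp add: integral_density integral_distr)

lemma integrable_compact_support:
  fixes f :: "real^'n \<Rightarrow> real"
  assumes "continuous_on UNIV f" "\<And>x. R < norm x \<Longrightarrow> f x = 0"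
  shows "integrable lborel f"
proof -
  have "integrable lborel (\<lambda>x. indicator (cball 0 R) x *\<^sub>R f x)"
    by (rule borel_integrable_compact) (use continuous_on_subset[OF assms(1)] in auto)
  moreover have "(\<lambda>x. indicator (cball 0 R) x *\<^sub>R f x) = f"
    using assms(2) by (auto simp: fun_eq_iff indicator_def not_le)
  ultimately show ?thesis by simp
qed

text \<open>The bound is an explicit parameter because the later estimates have to be linear in it,
  with constants chosen before the function.\<close>

definition bounded_borel :: "real \<Rightarrow> (real^'n \<Rightarrow> real) \<Rightarrow> bool" where
  "bounded_borel G g \<longleftrightarrow> g \<in> borel_measurable borel \<and> (\<forall>x. \<bar>g x\<bar> \<le> G)"

lemma bounded_borel_measurable [dest]: "bounded_borel G g \<Longrightarrow> g \<in> borel_measurable borel"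
  and bounded_borelD: "bounded_borel G g \<Longrightarrow> \<bar>g x\<bar> \<le> G"
  by (simp_all add: bounded_borel_def)

lemma bounded_borel_nonneg: "bounded_borel G g \<Longrightarrow> 0 \<le> G"
  using bounded_borelD abs_ge_zero order_trans by blast

lemma bounded_borel_affine: "bounded_borel G g \<Longrightarrow> bounded_borel G (\<lambda>x. g (a + c *\<^sub>R x))"
  by (auto simp: bounded_borel_def)

lemma integral_bounded_mult:
  fixes w :: "real^'n \<Rightarrow> real"
  assumes g: "bounded_borel G g" and w: "integrable lborel w"
  shows "integrable lborel (\<lambda>x. g x * w x)" "\<bar>LINT x|lborel. g x * w x\<bar> \<le> G * (LINT x|lborel. \<bar>w x\<bar>)"
proof -
  have [measurable]: "g \<in> borel_measurable borel" "w \<in> borel_measurable borel" using g w by auto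
  have G: "0 \<le> G" by (rule bounded_borel_nonneg[OF g])
  have b: "\<bar>g x * w x\<bar> \<le> G * \<bar>w x\<bar>" for x
    unfolding abs_mult using bounded_borelD[OF g] by (intro mult_right_mono) auto
  have i: "integrable lborel (\<lambda>x. G * \<bar>w x\<bar>)" using w by simp
  show *: "integrable lborel (\<lambda>x. g x * w x)"
    by (rule Bochner_Integration.integrable_bound[OF i]) (use b G in \<open>auto simp: abs_mult\<close>)
  have "\<bar>LINT x|lborel. g x * w x\<bar> \<le> (LINT x|lborel. \<bar>g x * w x\<bar>)" by (rule integral_abs_bound)
  also have "\<dots> \<le> (LINT x|lborel. G * \<bar>w x\<bar>)" using * i b by (intro integral_mono) auto
  finally show "\<bar>LINT x|lborel. g x * w x\<bar> \<le> G * (LINT x|lborel. \<bar>w x\<bar>)" by simp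
qed

text \<open>Integrability on the product comes from domination by \<open>K\<close> times the
  indicator of a product of two balls, a set of finite measure.\<close>

lemma Fubini_bounded_support:
  fixes H :: "real^'n \<Rightarrow> real^'n \<Rightarrow> real"
  assumes [measurable]: "(\<lambda>(x, y). H x y) \<in> borel_measurable (borel \<Otimes>\<^sub>M borel)"
    and b: "\<And>x y. \<bar>H x y\<bar> \<le> K"
    and s: "\<And>x y. R < norm x \<or> R < norm y \<Longrightarrow> H x y = 0"
  shows "(LINT x|lborel. LINT y|lborel. H x y) = (LINT y|lborel. LINT x|lborel. H x y)"
proof (rule lborel_pair.Fubini_integral[symmetric])
  let ?S = "cball (0::real^'n) R \<times> cball (0::real^'n) R"
  have "emeasure lborel ?S < \<infinity>"
    by (rule emeasure_bounded_finite) (intro bounded_Times bounded_cball)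
  then have i: "integrable (lborel :: ((real^'n) \<times> (real^'n)) measure) (\<lambda>p. K * indicator ?S p)"
    by (intro integrable_mult_right integrable_real_indicator)
      (auto intro!: borel_closed closed_Times)
  have K: "0 \<le> K" using b abs_ge_zero order_trans by blast
  have "integrable (lborel :: ((real^'n) \<times> (real^'n)) measure) (\<lambda>(x, y). H x y)"
  proof (rule Bochner_Integration.integrable_bound[OF i])
    show "(\<lambda>(x, y). H x y) \<in> borel_measurable lborel"
      using assms(1) by (simp add: borel_prod)
    show "AE p in lborel. norm (case p of (x, y) \<Rightarrow> H x y) \<le> norm (K * indicator ?S p)"
      using b s K by (auto simp: indicator_def not_le split: prod.split)
  qed
  then show "integrable (lborel \<Otimes>\<^sub>M lborel) (\<lambda>(x, y). H x y)" by (simp add: lborel_prod)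
qed

section \<open>Vanishing moments against Taylor polynomials\<close>

definition vanishing_moments :: "nat \<Rightarrow> (real^'n \<Rightarrow> real) \<Rightarrow> bool" where
  "vanishing_moments L w \<longleftrightarrow> (\<forall>\<alpha>::'n \<Rightarrow> nat. (\<Sum>i\<in>UNIV. \<alpha> i) \<le> L \<longrightarrow>
     (LINT x|lborel. w x * (\<Prod>i\<in>UNIV. (x $ i) ^ \<alpha> i)) = 0)"

text \<open>The monomial in front is the generalisation that carries the induction: unfolding one
  layer of \<open>dir_deriv\<close> produces a factor \<open>z $ i\<close>, which is absorbed into
  \<open>\<alpha>\<close> while \<open>k\<close> drops by one. The total degree stays at most
  \<open>L\<close>.\<close>

lemma integral_monomial_dir_deriv:
  fixes w :: "real^'n \<Rightarrow> real"
  assumes w: "continuous_on UNIV w" "\<And>x. R < norm x \<Longrightarrow> w x = 0" "vanishing_moments L w"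
  shows "(\<Sum>i\<in>UNIV. \<alpha> i) + k \<le> L \<Longrightarrow>
    (LINT z|lborel. w z * (\<Prod>i\<in>UNIV. (z $ i) ^ \<alpha> i) * dir_deriv k f z x) = 0"
proof (induction k arbitrary: f \<alpha>)
  case 0
  then show ?case using w(3) by (simp add: vanishing_moments_def)
next
  case (Suc k)
  let ?\<beta> = "\<lambda>i. \<alpha>(i := Suc (\<alpha> i))"
  have m: "(\<Prod>j\<in>UNIV. (z $ j) ^ ?\<beta> i j) = (\<Prod>j\<in>UNIV. (z $ j) ^ \<alpha> j) * z $ i" for i and z :: "real^'n"
  proof -
    have "(\<Prod>j\<in>UNIV. (z $ j) ^ ?\<beta> i j) = (\<Prod>j\<in>UNIV. (z $ j) ^ \<alpha> j * (if j = i then z $ j else 1))"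
      by (rule prod.cong) auto
    then show ?thesis by (simp add: prod.distrib)
  qed
  have "(\<Sum>j\<in>UNIV. ?\<beta> i j) = (\<Sum>j\<in>UNIV. \<alpha> j + (if j = i then 1 else 0))" for i
    by (rule sum.cong) auto
  then have b: "(\<Sum>j\<in>UNIV. ?\<beta> i j) + k \<le> L" for i using Suc.prems by (simp add: sum.distrib)
  have "(LINT z|lborel. w z * (\<Prod>i\<in>UNIV. (z $ i) ^ \<alpha> i) * dir_deriv (Suc k) f z x)
      = (LINT z|lborel. (\<Sum>i\<in>UNIV. w z * (\<Prod>j\<in>UNIV. (z $ j) ^ ?\<beta> i j) * dir_deriv k (partial i f) z x))"
    unfolding m dir_deriv.simps by (simp add: sum_distrib_left mult_ac)
  also have "\<dots> = (\<Sum>i\<in>UNIV. LINT z|lborel. w z * (\<Prod>j\<in>UNIV. (z $ j) ^ ?\<beta> i j) * dir_deriv k (partial i f) z x)"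
    by (rule Bochner_Integration.integral_sum,
        rule integrable_compact_support[where R = R])
      (use w(2) in \<open>auto intro!: continuous_intros w(1) continuous_on_dir_deriv\<close>)
  also have "\<dots> = 0" using Suc.IH[OF b] by simp
  finally show ?case .
qed

text \<open>The Taylor polynomial of \<open>\<eta>\<close> at \<open>v\<close> of degree below
  \<open>m\<close> is orthogonal to \<open>w\<close>, as a function of \<open>z\<close>, because
  \<open>m \<le> L\<close>. Only the remainder survives, and on the support of \<open>w\<close> it
  is of order \<open>\<delta> ^ m\<close>, uniformly in \<open>v\<close>.\<close>

lemma vanishing_moments_integral_bound:
  fixes w \<eta> :: "real^'n \<Rightarrow> real"
  assumes w: "continuous_on UNIV w" "\<And>x. R < norm x \<Longrightarrow> w x = 0" "vanishing_moments L w"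
    and "m \<le> L" "Ck m \<eta>" "Ck_bound m M \<eta>" "0 \<le> M" "0 \<le> R" "0 \<le> \<delta>"
  shows "\<bar>LINT z|lborel. \<eta> (v - \<delta> *\<^sub>R z) * w z\<bar>
    \<le> M * (real CARD('n) * R) ^ m * (LINT z|lborel. \<bar>w z\<bar>) * \<delta> ^ m"
proof -
  define T where "T z = (\<Sum>k<m. dir_deriv k \<eta> z v / fact k * (- \<delta>) ^ k)" for z
  have cT: "continuous_on UNIV T"
    unfolding T_def by (intro continuous_intros continuous_on_dir_deriv) auto
  have c\<eta>: "continuous_on UNIV (\<lambda>z. \<eta> (v - \<delta> *\<^sub>R z))"
    by (rule continuous_on_compose2[OF Ck_imp_continuous[OF assms(5)]]) (auto intro!: continuous_intros)
  have i: "integrable lborel (\<lambda>z. g z * w z)" if "continuous_on UNIV g" for g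
    by (rule integrable_compact_support[where R = R])
      (use w(2) in \<open>auto intro!: continuous_intros w(1) that\<close>)
  have "(LINT z|lborel. T z * w z)
      = (\<Sum>k<m. LINT z|lborel. (dir_deriv k \<eta> z v / fact k * (- \<delta>) ^ k) * w z)"
    unfolding T_def sum_distrib_right
    by (intro Bochner_Integration.integral_sum i continuous_intros continuous_on_dir_deriv) auto
  also have "\<dots> = (\<Sum>k<m. (- \<delta>) ^ k / fact k * (LINT z|lborel. w z * (\<Prod>i\<in>UNIV. (z $ i) ^ 0) * dir_deriv k \<eta> z v))"
    by (intro sum.cong refl, subst integral_mult_right_zero[symmetric]) (simp add: mult_ac)
  also have "\<dots> = 0"
    using integral_monomial_dir_deriv[OF w, where \<alpha> = "\<lambda>_. 0"] \<open>m \<le> L\<close> by (intro sum.neutral) auto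
  finally have "(LINT z|lborel. \<eta> (v - \<delta> *\<^sub>R z) * w z) = (LINT z|lborel. (\<eta> (v - \<delta> *\<^sub>R z) - T z) * w z)"
    using i[OF cT] i[OF c\<eta>] by (simp add: left_diff_distrib)
  also have "\<bar>\<dots>\<bar> \<le> (LINT z|lborel. \<bar>(\<eta> (v - \<delta> *\<^sub>R z) - T z) * w z\<bar>)" by (rule integral_abs_bound)
  also have "\<dots> \<le> (LINT z|lborel. M * (real CARD('n) * R) ^ m * \<delta> ^ m * \<bar>w z\<bar>)"
  proof (rule integral_mono)
    show "integrable lborel (\<lambda>z. \<bar>(\<eta> (v - \<delta> *\<^sub>R z) - T z) * w z\<bar>)"
      by (intro integrable_abs i continuous_intros cT c\<eta>)
    show "integrable lborel (\<lambda>z. M * (real CARD('n) * R) ^ m * \<delta> ^ m * \<bar>w z\<bar>)"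
      using integrable_compact_support[OF w(1,2)] by (intro integrable_mult_right integrable_abs) auto
    fix z
    show "\<bar>(\<eta> (v - \<delta> *\<^sub>R z) - T z) * w z\<bar> \<le> M * (real CARD('n) * R) ^ m * \<delta> ^ m * \<bar>w z\<bar>"
    proof (cases "norm z \<le> R")
      case True
      have "\<bar>\<eta> (v - \<delta> *\<^sub>R z) - T z\<bar> \<le> M * (real CARD('n) * norm z * \<delta>) ^ m"
        using taylor_along_line[OF assms(5,6), of v "-\<delta>" z] \<open>0 \<le> \<delta>\<close> by (simp add: T_def)
      also have "\<dots> \<le> M * (real CARD('n) * R * \<delta>) ^ m"
        using True assms by (intro mult_left_mono power_mono mult_right_mono) auto
      finally show ?thesis unfolding abs_mult
        by (intro mult_right_mono) (auto simp: power_mult_distrib mult_ac)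
    qed (use w(2) in auto)
  qed
  finally show ?thesis by (simp add: mult_ac)
qed

section \<open>Decay of wavelet coefficients\<close>

lemma bounded_borel_scale:
  assumes "bounded_borel G g" shows "bounded_borel (\<bar>c\<bar> * G) (\<lambda>x. c * g x)"
  using assms by (auto simp: bounded_borel_def abs_mult intro!: mult_left_mono)

lemma bounded_borel_sum:
  assumes "finite A" "\<And>r. r \<in> A \<Longrightarrow> bounded_borel (G r) (g r)"
  shows "bounded_borel (\<Sum>r\<in>A. G r) (\<lambda>x. \<Sum>r\<in>A. g r x)"
  using assms unfolding bounded_borel_def
  by (intro conjI borel_measurable_sum allI order_trans[OF sum_abs] sum_mono) auto

text \<open>After division by \<open>p ^ j\<close> this is a geometric series with ratio
  \<open>d / p < 1\<close>, dominated by the indices \<open>i\<close> near \<open>j\<close>. Both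
  analysis and synthesis use it with \<open>p = 2^-s\<close> and \<open>d = 2^-m\<close>.\<close>

lemma geometric_convolution_bound:
  fixes p d :: real
  assumes "0 < d" "d < p"
  shows "(\<Sum>i<j. p ^ i * d ^ (j - i)) \<le> p ^ j * (d / (p - d))"
proof (induction j)
  case (Suc j)
  have "(\<Sum>i<Suc j. p ^ i * d ^ (Suc j - i)) = d * (\<Sum>i<j. p ^ i * d ^ (j - i)) + p ^ j * d"
    by (simp add: sum_distrib_left Suc_diff_le mult_ac)
  also have "\<dots> \<le> d * (p ^ j * (d / (p - d))) + p ^ j * d"
    using Suc assms by (intro add_mono mult_left_mono) auto
  also have "\<dots> = p ^ Suc j * (d / (p - d))"
    using assms by (simp add: field_simps)
  finally show ?case .
qed (use assms in simp)

section \<open>Mollification at a given scale\<close>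

locale smoothing_kernel =
  fixes \<eta> :: "real^'n \<Rightarrow> real" and R :: real and m :: nat
  assumes Ck_kernel: "Ck m \<eta>"
    and kernel_support: "\<And>x. R < norm x \<Longrightarrow> \<eta> x = 0"
    and radius_nonneg: "0 \<le> R"
    and kernel_integral: "(LINT x|lborel. \<eta> x) = 1"
begin

lemma kernel_continuous: "continuous_on UNIV \<eta>"
  by (rule Ck_imp_continuous[OF Ck_kernel])

lemma kernel_measurable [measurable]: "\<eta> \<in> borel_measurable borel"
  by (rule borel_measurable_continuous_onI[OF kernel_continuous])

lemma kernel_integrable: "integrable lborel \<eta>"
  by (rule integrable_compact_support[OF kernel_continuous kernel_support])

text \<open>The locale imposes no sign on the kernel, so its L^1 norm is kept apart from its
  integral.\<close>

definition mass :: real where "mass = (LINT x|lborel. \<bar>\<eta> x\<bar>)"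

lemma mass_nonneg: "0 \<le> mass" by (simp add: mass_def)

definition smooth :: "real \<Rightarrow> (real^'n \<Rightarrow> real) \<Rightarrow> real^'n \<Rightarrow> real" where
  "smooth \<tau> g x = (LINT u|lborel. g (x + \<tau> *\<^sub>R u) * \<eta> u)"

lemma smooth_integrable: "bounded_borel G g \<Longrightarrow> integrable lborel (\<lambda>u. g (x + \<tau> *\<^sub>R u) * \<eta> u)"
  by (rule integral_bounded_mult[OF bounded_borel_affine kernel_integrable])

lemma smooth_bounded_borel:
  assumes g: "bounded_borel G g" shows "bounded_borel (G * mass) (smooth \<tau> g)"
  unfolding bounded_borel_def
proof safe
  have [measurable]: "g \<in> borel_measurable borel" using g by auto
  show "smooth \<tau> g \<in> borel_measurable borel"
    unfolding smooth_def by measurable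
  show "\<bar>smooth \<tau> g x\<bar> \<le> G * mass" for x
    unfolding smooth_def mass_def by (rule integral_bounded_mult[OF bounded_borel_affine[OF g] kernel_integrable])
qed

lemma smooth_diff:
  assumes "bounded_borel G g" "bounded_borel H h"
  shows "smooth \<tau> (\<lambda>x. g x - h x) x = smooth \<tau> g x - smooth \<tau> h x"
  using smooth_integrable[OF assms(1)] smooth_integrable[OF assms(2)]
  by (simp add: smooth_def left_diff_distrib)

lemma smooth_sum:
  assumes "\<And>r. r \<in> A \<Longrightarrow> bounded_borel (G r) (g r)"
  shows "smooth \<tau> (\<lambda>x. \<Sum>r\<in>A. c r * g r x) x = (\<Sum>r\<in>A. c r * smooth \<tau> (g r) x)"
proof -
  have "smooth \<tau> (\<lambda>x. \<Sum>r\<in>A. c r * g r x) x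
      = (LINT u|lborel. (\<Sum>r\<in>A. c r * (g r (x + \<tau> *\<^sub>R u) * \<eta> u)))"
    by (simp only: smooth_def sum_distrib_right mult.assoc)
  also have "\<dots> = (\<Sum>r\<in>A. LINT u|lborel. c r * (g r (x + \<tau> *\<^sub>R u) * \<eta> u))"
    by (intro Bochner_Integration.integral_sum integrable_mult_right smooth_integrable[OF assms])
  finally show ?thesis by (simp add: smooth_def)
qed

text \<open>Both sides are the double integral of \<open>g (x + \<sigma> u + \<tau> v)\<close>
  against \<open>\<eta> u\<close> and \<open>\<eta> v\<close>, in opposite orders of
  integration.\<close>

lemma smooth_commute:
  assumes g: "bounded_borel G g"
  shows "smooth \<sigma> (smooth \<tau> g) x = smooth \<tau> (smooth \<sigma> g) x"
proof -
  have [measurable]: "g \<in> borel_measurable borel" using g by auto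
  obtain M where M: "0 \<le> M" "\<And>x. \<bar>\<eta> x\<bar> \<le> M"
    using bounded_if_compact_support[OF kernel_continuous kernel_support] by blast
  let ?H = "\<lambda>u v. g (x + \<sigma> *\<^sub>R u + \<tau> *\<^sub>R v) * \<eta> v * \<eta> u"
  have "smooth \<sigma> (smooth \<tau> g) x = (LINT u|lborel. LINT v|lborel. ?H u v)"
    by (simp add: smooth_def)
  also have "\<dots> = (LINT v|lborel. LINT u|lborel. ?H u v)"
  proof (rule Fubini_bounded_support)
    show "(\<lambda>(u, v). ?H u v) \<in> borel_measurable (borel \<Otimes>\<^sub>M borel)" by measurable
    show "\<bar>?H u v\<bar> \<le> G * M * M" for u v
      unfolding abs_mult using M bounded_borelD[OF g] bounded_borel_nonneg[OF g]
      by (intro mult_mono) auto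
    show "?H u v = 0" if "R < norm u \<or> R < norm v" for u v
      using kernel_support that by auto
  qed
  also have "\<dots> = (LINT v|lborel. LINT u|lborel. g (x + \<tau> *\<^sub>R v + \<sigma> *\<^sub>R u) * \<eta> u * \<eta> v)"
    by (simp add: mult_ac add_ac)
  also have "\<dots> = smooth \<tau> (smooth \<sigma> g) x" by (simp add: smooth_def)
  finally show ?thesis .
qed

text \<open>\<open>g\<close> is merely bounded and measurable. A translation of the smoothing
  variable moves the dependence on \<open>z\<close> from \<open>g\<close> to the kernel; after
  Fubini, \<open>w\<close> is integrated against \<open>\<eta>\<close> and its moments gain the
  \<open>m\<close>-th power of the ratio of the two scales.\<close>

lemma smooth_moment_bound:
  fixes w :: "real^'n \<Rightarrow> real"
  assumes w: "continuous_on UNIV w" "\<And>x. S < norm x \<Longrightarrow> w x = 0" "vanishing_moments L w"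
    and S: "0 \<le> S" and "m \<le> L"
  obtains C where "0 \<le> C" "\<And>G g a \<rho> \<tau>. bounded_borel G g \<Longrightarrow> 0 < \<rho> \<Longrightarrow> \<rho> \<le> \<tau> \<Longrightarrow>
    \<bar>LINT z|lborel. smooth \<tau> g (a + \<rho> *\<^sub>R z) * w z\<bar> \<le> C * G * (\<rho> / \<tau>) ^ m"
proof -
  obtain M0 where "Ck_bound m M0 \<eta>"
    using Ck_bound_if_compact_support[OF Ck_kernel kernel_support] by blast
  then obtain M where M: "0 \<le> M" "Ck_bound m M \<eta>" using Ck_bound_mono[of m M0 \<eta> "max M0 0"] max.cobounded1 max.cobounded2
    by blast
  obtain B where B: "0 \<le> B" "\<And>x. \<bar>\<eta> x\<bar> \<le> B"
    using bounded_if_compact_support[OF kernel_continuous kernel_support] by blast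
  obtain W where W: "0 \<le> W" "\<And>x. \<bar>w x\<bar> \<le> W"
    using bounded_if_compact_support[OF w(1,2)] by blast
  have [measurable]: "w \<in> borel_measurable borel" by (rule borel_measurable_continuous_onI[OF w(1)])
  define C1 where "C1 = M * (real CARD('n) * S) ^ m * (LINT z|lborel. \<bar>w z\<bar>)"
  have C1: "0 \<le> C1" using M(1) S by (simp add: C1_def)
  define V where "V = (LINT v|lborel. \<bar>indicator (cball (0::real^'n) (R + S)) v :: real\<bar>)"
  have iV: "integrable lborel (indicator (cball (0::real^'n) (R + S)) :: _ \<Rightarrow> real)"
    by (intro integrable_real_indicator) (use emeasure_bounded_finite[OF bounded_cball] in \<open>auto simp: top.not_eq_extremum\<close>)
  have "\<bar>LINT z|lborel. smooth \<tau> g (a + \<rho> *\<^sub>R z) * w z\<bar> \<le> C1 * V * G * (\<rho> / \<tau>) ^ m"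
    if g: "bounded_borel G g" and \<rho>: "0 < \<rho>" "\<rho> \<le> \<tau>" for G g a \<rho> \<tau>
  proof -
    define \<delta> where "\<delta> = \<rho> / \<tau>"
    have \<delta>: "0 \<le> \<delta>" "\<delta> \<le> 1" "\<delta> * \<tau> = \<rho>" using \<rho> by (auto simp: \<delta>_def)
    have [measurable]: "g \<in> borel_measurable borel" using g by auto
    have G: "0 \<le> G" by (rule bounded_borel_nonneg[OF g])
    let ?H = "\<lambda>z v. g (a + \<tau> *\<^sub>R v) * \<eta> (v - \<delta> *\<^sub>R z) * w z"
    \<comment> \<open>Substituting \<open>u = v - \<delta> z\<close> with
      \<open>\<delta> \<tau> = \<rho>\<close> turns the argument
      \<open>a + \<rho> z + \<tau> u\<close> into \<open>a + \<tau> v\<close>.\<close>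
    have sm: "smooth \<tau> g (a + \<rho> *\<^sub>R z) = (LINT v|lborel. g (a + \<tau> *\<^sub>R v) * \<eta> (v - \<delta> *\<^sub>R z))" for z
      unfolding smooth_def
      by (subst lborel_integral_affine[where c = 1 and t = "- \<delta> *\<^sub>R z"])
        (simp_all add: scaleR_diff_right \<delta>(3) algebra_simps)
    \<comment> \<open>Because \<open>\<delta> \<le> 1\<close>, the integrand lives in a ball of
      radius \<open>R + S\<close>. Its volume \<open>V\<close>, and hence the final constant, does
      not depend on the scales.\<close>
    have Hs: "?H z v = 0" if "R + S < norm z \<or> R + S < norm v" for z v
    proof (cases "norm z \<le> S")
      case True
      then have "R + S < norm v" using that radius_nonneg by auto
      moreover have "\<delta> * norm z \<le> 1 * S" using \<delta> True by (intro mult_mono) auto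
      ultimately have "R < norm (v - \<delta> *\<^sub>R z)"
        using norm_triangle_ineq2[of v "\<delta> *\<^sub>R z"] \<delta>(1) by simp
      then show ?thesis using kernel_support by simp
    qed (use w(2) in auto)
    define k where "k v = (LINT z|lborel. \<eta> (v - \<delta> *\<^sub>R z) * w z)" for v
    have [measurable]: "k \<in> borel_measurable borel" unfolding k_def by measurable
    have kb: "\<bar>k v\<bar> \<le> C1 * \<delta> ^ m" for v
      unfolding k_def C1_def
      by (rule vanishing_moments_integral_bound[OF w \<open>m \<le> L\<close> Ck_kernel M(2,1) S \<delta>(1)])
    have "(LINT z|lborel. smooth \<tau> g (a + \<rho> *\<^sub>R z) * w z) = (LINT z|lborel. LINT v|lborel. ?H z v)"
      by (simp add: sm)
    also have "\<dots> = (LINT v|lborel. LINT z|lborel. ?H z v)"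
    proof (rule Fubini_bounded_support)
      show "(\<lambda>(z, v). ?H z v) \<in> borel_measurable (borel \<Otimes>\<^sub>M borel)" by measurable
      show "\<bar>?H z v\<bar> \<le> G * B * W" for z v
        unfolding abs_mult using B W bounded_borelD[OF g] G by (intro mult_mono) auto
    qed (rule Hs)
    also have "\<dots> = (LINT v|lborel. (g (a + \<tau> *\<^sub>R v) * k v) * indicator (cball 0 (R + S)) v)"
    proof (rule Bochner_Integration.integral_cong[OF refl])
      fix v
      have "(LINT z|lborel. ?H z v) = g (a + \<tau> *\<^sub>R v) * k v"
        unfolding k_def mult.assoc by simp
      moreover have "(LINT z|lborel. ?H z v) = 0" if "R + S < norm v"
        by (simp only: Hs[OF disjI2[OF that]]) simp
      ultimately show "(LINT z|lborel. ?H z v) = (g (a + \<tau> *\<^sub>R v) * k v) * indicator (cball 0 (R + S)) v"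
        by (auto simp: indicator_def)
    qed
    also have "\<bar>\<dots>\<bar> \<le> (G * (C1 * \<delta> ^ m)) * V"
      unfolding V_def
    proof (rule integral_bounded_mult(2)[OF _ iV])
      show "bounded_borel (G * (C1 * \<delta> ^ m)) (\<lambda>v. g (a + \<tau> *\<^sub>R v) * k v)"
        unfolding bounded_borel_def abs_mult using kb bounded_borelD[OF g] G
        by (auto intro!: mult_mono)
    qed
    finally show ?thesis by (simp add: \<delta>_def mult_ac)
  qed
  moreover have "0 \<le> C1 * V" using C1 by (simp add: V_def)
  ultimately show thesis using that by blast
qed

text \<open>The coefficients are those of the \<open>m\<close>-th difference, so that \<open>f - quasi t f\<close> averages
  \<open>m\<close>-th differences of \<open>f\<close> with steps \<open>t u\<close>.\<close>
definition quasi :: "real \<Rightarrow> (real^'n \<Rightarrow> real) \<Rightarrow> real^'n \<Rightarrow> real" where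
  "quasi t g x = (\<Sum>r=1..m. (-1) ^ Suc r * real (m choose r) * smooth (real r * t) g x)"

text \<open>This is \<open>2 ^ m - 1\<close>, the l^1 norm of the coefficients of
  \<open>quasi\<close>.\<close>

definition binsum :: real where "binsum = (\<Sum>r=1..m. real (m choose r))"

lemma binsum_nonneg: "0 \<le> binsum" by (simp add: binsum_def sum_nonneg)

lemma quasi_bounded_borel:
  assumes g: "bounded_borel G g" shows "bounded_borel (binsum * mass * G) (quasi t g)"
proof -
  have "bounded_borel (\<Sum>r=1..m. \<bar>(-1) ^ Suc r * real (m choose r)\<bar> * (G * mass)) (quasi t g)"
    unfolding quasi_def by (intro bounded_borel_sum bounded_borel_scale smooth_bounded_borel[OF g]) auto
  then show ?thesis by (simp add: abs_mult binsum_def sum_distrib_left mult_ac)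
qed

lemma quasi_diff:
  assumes "bounded_borel G g" "bounded_borel H h"
  shows "quasi t (\<lambda>x. g x - h x) x = quasi t g x - quasi t h x"
  by (simp only: quasi_def smooth_diff[OF assms] right_diff_distrib sum_subtractf)

lemma quasi_commute:
  assumes g: "bounded_borel G g"
  shows "quasi t (quasi u g) x = quasi u (quasi t g) x"
proof -
  let ?c = "\<lambda>r. (-1) ^ Suc r * real (m choose r)"
  have e: "quasi t (quasi u g) x
      = (\<Sum>r=1..m. \<Sum>q=1..m. ?c r * (?c q * smooth (real r * t) (smooth (real q * u) g) x))" for t u
    unfolding quasi_def[of t] quasi_def[of u, abs_def]
    by (simp only: smooth_sum[OF smooth_bounded_borel[OF g]] sum_distrib_left)
  have "quasi t (quasi u g) x
      = (\<Sum>q=1..m. \<Sum>r=1..m. ?c r * (?c q * smooth (real r * t) (smooth (real q * u) g) x))"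
    unfolding e by (rule sum.swap)
  also have "\<dots> = quasi u (quasi t g) x"
    unfolding e by (intro sum.cong refl) (simp add: smooth_commute[OF g, of "real _ * t"])
  finally show ?thesis .
qed

lemma quasi_error:
  assumes f: "bounded_borel B f" and "0 < s" "0 < t"
    and d: "\<And>h x. \<bar>diffk m h f x\<bar> \<le> D * norm h powr s"
  shows "\<bar>f x - quasi t f x\<bar> \<le> D * (t * R) powr s * mass"
proof -
  have D: "0 \<le> D"
  proof -
    \<comment> \<open>Any unit step works here: its norm raised to the power \<open>s\<close> is
      1.\<close>
    have "0 \<le> D * norm (axis undefined 1 :: real^'n) powr s"
      using order_trans[OF abs_ge_zero d] .
    then show ?thesis by simp
  qed
  have [measurable]: "f \<in> borel_measurable borel" using f by auto
  define e where "e u = f x - (\<Sum>r=1..m. (-1) ^ Suc r * real (m choose r) * f (x + (real r * t) *\<^sub>R u))" for u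
  \<comment> \<open>\<open>diffk\<close> is centred. Moving the base point by
    \<open>(m/2) t u\<close> places its nodes at \<open>x + r t u\<close> for
    \<open>r = 0, ..., m\<close>; the node \<open>r = 0\<close> is \<open>f x\<close> itself and the
    others are those of \<open>quasi\<close>.\<close>
  have e_diffk: "e u = (-1) ^ m * diffk m (t *\<^sub>R u) f (x + (real m / 2) *\<^sub>R (t *\<^sub>R u))" for u
  proof -
    have "diffk m (t *\<^sub>R u) f (x + (real m / 2) *\<^sub>R (t *\<^sub>R u))
        = (\<Sum>r\<le>m. (-1) ^ (m + r) * real (m choose r) * f (x + (real r * t) *\<^sub>R u))"
      unfolding diffk_expand
      by (intro sum.cong refl arg_cong2[where f = "(*)"] arg_cong[where f = f])
        (simp add: algebra_simps)
    then have "(-1) ^ m * diffk m (t *\<^sub>R u) f (x + (real m / 2) *\<^sub>R (t *\<^sub>R u))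
        = (\<Sum>r\<le>m. (-1) ^ r * real (m choose r) * f (x + (real r * t) *\<^sub>R u))"
      by (simp add: sum_distrib_left power_add mult.assoc[symmetric] flip: power_mult_distrib)
    also have "{..m} = insert 0 {1..m}" by auto
    finally show ?thesis by (simp add: e_def sum_negf)
  qed
  have i: "integrable lborel (\<lambda>u. f (x + c *\<^sub>R u) * \<eta> u)" for c by (rule smooth_integrable[OF f])
  have "f x - quasi t f x = (LINT u|lborel. e u * \<eta> u)"
  proof -
    have "(LINT u|lborel. e u * \<eta> u) = (LINT u|lborel. f x * \<eta> u -
        (\<Sum>r=1..m. (-1) ^ Suc r * real (m choose r) * (f (x + (real r * t) *\<^sub>R u) * \<eta> u)))"
      unfolding e_def left_diff_distrib sum_distrib_right by (simp add: mult_ac)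
    also have "\<dots> = (LINT u|lborel. f x * \<eta> u) - (LINT u|lborel.
        (\<Sum>r=1..m. (-1) ^ Suc r * real (m choose r) * (f (x + (real r * t) *\<^sub>R u) * \<eta> u)))"
      by (intro Bochner_Integration.integral_diff Bochner_Integration.integrable_sum
            integrable_mult_right i kernel_integrable)
    also have "(LINT u|lborel. (\<Sum>r=1..m. (-1) ^ Suc r * real (m choose r) * (f (x + (real r * t) *\<^sub>R u) * \<eta> u)))
        = quasi t f x"
      unfolding quasi_def smooth_def
      by (subst Bochner_Integration.integral_sum) (auto intro!: integrable_mult_right i)
    finally show ?thesis using kernel_integral by simp
  qed
  \<comment> \<open>Restricting to the support of the kernel makes the steps \<open>t u\<close> at
    most \<open>t R\<close> long, so that \<open>e\<close> is bounded there.\<close>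
  also have "\<dots> = (LINT u|lborel. (e u * indicator (cball 0 R) u) * \<eta> u)"
    using kernel_support by (intro Bochner_Integration.integral_cong refl) (auto simp: indicator_def not_le)
  also have "\<bar>\<dots>\<bar> \<le> D * (t * R) powr s * mass"
    unfolding mass_def
  proof (rule integral_bounded_mult(2)[OF _ kernel_integrable])
    have "\<bar>e u\<bar> \<le> D * (t * R) powr s" if "norm u \<le> R" for u
    proof -
      have "\<bar>e u\<bar> \<le> D * norm (t *\<^sub>R u) powr s"
        using d[of "t *\<^sub>R u"] by (simp only: e_diffk abs_mult power_abs) simp
      also have "\<dots> \<le> D * (t * R) powr s"
        using that \<open>0 < t\<close> \<open>0 < s\<close> D by (intro mult_left_mono powr_mono2) auto
      finally show ?thesis .
    qed
    moreover have "e \<in> borel_measurable borel" unfolding e_def by measurable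
    ultimately show "bounded_borel (D * (t * R) powr s) (\<lambda>u. e u * indicator (cball 0 R) u)"
      using D by (auto simp: bounded_borel_def indicator_def)
  qed
  finally show ?thesis .
qed

text \<open>With \<open>P\<^sub>i = quasi (2\<^sup>-\<^sup>i)\<close>, commutativity gives
  \<open>P\<^sub>i\<^sub>+\<^sub>1\<^sup>2 - P\<^sub>i\<^sup>2 = (P\<^sub>i\<^sub>+\<^sub>1 + P\<^sub>i) (P\<^sub>i\<^sub>+\<^sub>1 - P\<^sub>i)\<close>: the inner difference is of size \<open>2\<^sup>-\<^sup>i\<^sup>s\<close> and the outer
  smoothing lets the vanishing moments of \<open>w\<close> act.\<close>
theorem coefficient_decay:
  fixes w :: "real^'n \<Rightarrow> real"
  assumes w: "continuous_on UNIV w" "\<And>x. S < norm x \<Longrightarrow> w x = 0" "vanishing_moments L w"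
    and S: "0 \<le> S" and mL: "m \<le> L" and s: "0 < s" "s < real m"
  obtains C where "0 \<le> C" "\<And>B f a j. bounded_borel B f \<Longrightarrow>
    (\<And>h x. \<bar>diffk m h f x\<bar> \<le> B * norm h powr s) \<Longrightarrow>
    \<bar>LINT z|lborel. f (a + (1/2) ^ j *\<^sub>R z) * w z\<bar> \<le> C * B * (2 powr (-s)) ^ j"
proof -
  obtain C1 where C1: "0 \<le> C1" "\<And>G g a \<rho> \<tau>. bounded_borel G g \<Longrightarrow> 0 < \<rho> \<Longrightarrow> \<rho> \<le> \<tau> \<Longrightarrow>
    \<bar>LINT z|lborel. smooth \<tau> g (a + \<rho> *\<^sub>R z) * w z\<bar> \<le> C1 * G * (\<rho> / \<tau>) ^ m"
    by (rule smooth_moment_bound[OF w S mL], assumption, rule that)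
  \<comment> \<open>Per dyadic scale, \<open>p\<close> is the decay of the smoothing error of
    \<open>f\<close> and \<open>d\<close> the gain from the moments. The hypothesis
    \<open>s < m\<close> becomes \<open>d < p\<close>.\<close>
  define p where "p = 2 powr (-s)"
  define d where "d = (1/2::real) ^ m"
  have d_powr: "d = 2 powr (- real m)"
    by (simp add: d_def powr_minus powr_realpow power_one_over field_simps)
  have d: "0 < d" "d < p" unfolding d_powr p_def using s by auto
  have p: "0 < p" "p < 1" using s by (auto simp: p_def powr_less_one)
  have iw: "integrable lborel w" by (rule integrable_compact_support[OF w(1,2)])
  define Nw where "Nw = (LINT z|lborel. \<bar>w z\<bar>)"
  define K where "K = binsum * C1"
  define E where "E = R powr s * mass"
  have K: "0 \<le> K" using binsum_nonneg C1 by (simp add: K_def)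
  have E: "0 \<le> E" using mass_nonneg by (simp add: E_def)
  have Nw: "0 \<le> Nw" by (simp add: Nw_def)
  \<comment> \<open>The four summands belong to the error at level \<open>j\<close>, the smoothed
    error at level \<open>j\<close>, the coarsest level, and the telescoping sum between levels
    \<open>0\<close> and \<open>j\<close>.\<close>
  define C where "C = Nw * E + K * E + K * binsum * mass + 4 * K * E / d * (d / (p - d))"
  have "\<bar>LINT z|lborel. f (a + (1/2) ^ j *\<^sub>R z) * w z\<bar> \<le> C * B * p ^ j"
    if f: "bounded_borel B f" and diff: "\<And>h x. \<bar>diffk m h f x\<bar> \<le> B * norm h powr s" for B f a j
  proof -
    have B: "0 \<le> B" by (rule bounded_borel_nonneg[OF f])
    define P where "P i = quasi ((1/2) ^ i)" for i :: nat
    define \<Phi> where "\<Phi> g = (LINT z|lborel. g (a + (1/2) ^ j *\<^sub>R z) * w z)" for g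
    have \<Phi>_bound: "\<bar>\<Phi> g\<bar> \<le> G * Nw" if "bounded_borel G g" for G g
      unfolding \<Phi>_def Nw_def by (rule integral_bounded_mult[OF bounded_borel_affine[OF that] iw])
    have \<Phi>_int: "integrable lborel (\<lambda>z. g (a + (1/2) ^ j *\<^sub>R z) * w z)" if "bounded_borel G g" for G g
      by (rule integral_bounded_mult[OF bounded_borel_affine[OF that] iw])
    have \<Phi>_diff: "\<Phi> (\<lambda>x. g x - h x) = \<Phi> g - \<Phi> h" if "bounded_borel G g" "bounded_borel H h" for G H g h
      unfolding \<Phi>_def left_diff_distrib
      by (rule Bochner_Integration.integral_diff[OF \<Phi>_int[OF that(1)] \<Phi>_int[OF that(2)]])
    have P_bb: "bounded_borel (binsum * mass * G) (P i g)" if "bounded_borel G g" for G g i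
      unfolding P_def by (rule quasi_bounded_borel[OF that])
    have \<Phi>P: "\<bar>\<Phi> (P i g)\<bar> \<le> K * G * d ^ (j - i)" if g: "bounded_borel G g" and "i \<le> j" for i G g
    proof -
      let ?t = "\<lambda>r. real r * (1/2) ^ i"
      have G: "0 \<le> G" by (rule bounded_borel_nonneg[OF g])
      have dji: "d ^ (j - i) = ((1/2) ^ (j - i)) ^ m"
        by (simp add: d_def mult.commute flip: power_mult)
      have hj: "(1/2::real) ^ j = (1/2) ^ i * (1/2) ^ (j - i)"
        using \<open>i \<le> j\<close> by (simp flip: power_add)
      have b: "\<bar>\<Phi> (smooth (?t r) g)\<bar> \<le> C1 * G * d ^ (j - i)" if "1 \<le> r" for r
      proof -
        have "(1/2::real) ^ (j - i) \<le> 1" by (simp add: power_le_one)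
        then have 1: "(1/2::real) ^ (j - i) \<le> real r" using that by linarith
        have "\<bar>\<Phi> (smooth (?t r) g)\<bar> \<le> C1 * G * ((1/2) ^ j / ?t r) ^ m"
          unfolding \<Phi>_def
        proof (rule C1(2)[OF g])
          show "(1/2) ^ j \<le> real r * (1/2) ^ i"
            unfolding hj using 1 by simp
        qed simp
        also have "(1/2) ^ j / ?t r = (1/2) ^ (j - i) / real r" unfolding hj by simp
        \<comment> \<open>The dilates with \<open>r > 1\<close> smooth at a coarser scale, so the
          bound for \<open>r = 1\<close> covers them.\<close>
        also have "C1 * G * ((1/2) ^ (j - i) / real r) ^ m \<le> C1 * G * ((1/2) ^ (j - i)) ^ m"
          using that C1(1) G by (intro mult_left_mono power_mono) (auto simp: divide_le_eq)
        finally show ?thesis by (simp only: dji)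
      qed
      have "\<Phi> (P i g) = (\<Sum>r=1..m. (-1) ^ Suc r * real (m choose r) * \<Phi> (smooth (?t r) g))"
      proof -
        have "\<Phi> (P i g) = (LINT z|lborel. (\<Sum>r=1..m. (-1) ^ Suc r * real (m choose r) *
            (smooth (?t r) g (a + (1/2) ^ j *\<^sub>R z) * w z)))"
          by (simp only: \<Phi>_def P_def quasi_def sum_distrib_right mult.assoc)
        also have "\<dots> = (\<Sum>r=1..m. LINT z|lborel. (-1) ^ Suc r * real (m choose r) *
            (smooth (?t r) g (a + (1/2) ^ j *\<^sub>R z) * w z))"
          by (intro Bochner_Integration.integral_sum integrable_mult_right \<Phi>_int[OF smooth_bounded_borel[OF g]])
        finally show ?thesis by (simp only: \<Phi>_def integral_mult_right_zero)
      qed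
      also have "\<bar>\<dots>\<bar> \<le> (\<Sum>r=1..m. real (m choose r) * (C1 * G * d ^ (j - i)))"
        by (intro order_trans[OF sum_abs] sum_mono) (use b in \<open>auto simp: abs_mult mult.assoc intro!: mult_left_mono\<close>)
      also have "\<dots> = K * G * d ^ (j - i)"
        unfolding sum_distrib_right[symmetric] by (simp add: K_def binsum_def mult_ac)
      finally show ?thesis .
    qed
    have err: "bounded_borel (B * E * p ^ i) (\<lambda>x. f x - P i f x)" for i
      unfolding bounded_borel_def
    proof safe
      show "(\<lambda>x. f x - P i f x) \<in> borel_measurable borel"
        using f P_bb[OF f] by (intro borel_measurable_diff) auto
      have "((1/2) ^ i * R) powr s = p ^ i * R powr s"
        using radius_nonneg
        by (simp add: powr_mult p_def powr_minus powr_divide inverse_eq_divide power_one_over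
            powr_powr mult.commute flip: powr_realpow)
      then show "\<bar>f x - P i f x\<bar> \<le> B * E * p ^ i" for x
        using quasi_error[OF f s(1) _ diff, of "(1/2) ^ i" x] by (simp add: P_def E_def mult_ac)
    qed
    have step: "\<bar>\<Phi> (P (Suc i) (P (Suc i) f)) - \<Phi> (P i (P i f))\<bar> \<le> 4 * K * E / d * B * (p ^ i * d ^ (j - i))"
      if "i < j" for i
    proof -
      define \<Delta> where "\<Delta> x = P (Suc i) f x - P i f x" for x
      have "\<bar>\<Delta> x\<bar> \<le> 2 * (B * E * p ^ i)" for x
      proof -
        have "\<bar>f x - P i f x\<bar> \<le> B * E * p ^ i" "\<bar>f x - P (Suc i) f x\<bar> \<le> B * E * p ^ Suc i"
          using err bounded_borelD by blast+
        moreover have "B * E * p ^ Suc i \<le> B * E * p ^ i"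
          using B E p by (intro mult_left_mono power_decreasing) auto
        ultimately show ?thesis unfolding \<Delta>_def by linarith
      qed
      then have \<Delta>: "bounded_borel (2 * (B * E * p ^ i)) \<Delta>"
        using P_bb[OF f] unfolding bounded_borel_def \<Delta>_def[abs_def]
        by (auto intro!: borel_measurable_diff)
      have PP: "bounded_borel (binsum * mass * (binsum * mass * B)) (P k (P l f))" for k l
        by (rule P_bb[OF P_bb[OF f]])
      have e: "\<Phi> (P k \<Delta>) = \<Phi> (P k (P (Suc i) f)) - \<Phi> (P k (P i f))" for k
      proof -
        have "P k \<Delta> = (\<lambda>x. P k (P (Suc i) f) x - P k (P i f) x)"
          unfolding \<Delta>_def[abs_def] P_def
          by (rule ext, rule quasi_diff) (use quasi_bounded_borel[OF f] in auto)
        then show ?thesis using \<Phi>_diff[OF PP PP] by simp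
      qed
      \<comment> \<open>Commutation cancels the two mixed products when the outer operators are
        applied to \<open>\<Delta>\<close> and the results are added.\<close>
      have "P (Suc i) (P i f) = P i (P (Suc i) f)"
        unfolding P_def by (rule ext) (rule quasi_commute[OF f])
      then have "\<Phi> (P (Suc i) (P (Suc i) f)) - \<Phi> (P i (P i f)) = \<Phi> (P (Suc i) \<Delta>) + \<Phi> (P i \<Delta>)"
        by (simp add: e)
      also have "\<bar>\<dots>\<bar> \<le> K * (2 * (B * E * p ^ i)) * d ^ (j - Suc i) + K * (2 * (B * E * p ^ i)) * d ^ (j - i)"
        using \<Phi>P[OF \<Delta>] that by (intro order_trans[OF abs_triangle_ineq] add_mono) auto
      \<comment> \<open>The outer smoothing at level \<open>Suc i\<close> gains one power of
        \<open>d\<close> less than the one at level \<open>i\<close>; this costs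
        \<open>1 / d\<close>. Two summands with a factor 2 each give the constant 4.\<close>
      also have "\<dots> \<le> K * (2 * (B * E * p ^ i)) * (d ^ (j - i) / d) + K * (2 * (B * E * p ^ i)) * (d ^ (j - i) / d)"
      proof (intro add_mono mult_left_mono)
        have "d ^ (j - i) = d * d ^ (j - Suc i)" using that by (simp add: Suc_diff_Suc flip: power_Suc)
        then show "d ^ (j - Suc i) \<le> d ^ (j - i) / d" using d by simp
        have "d \<le> 1" using d p by simp
        then show "d ^ (j - i) \<le> d ^ (j - i) / d" using d by (simp add: le_divide_eq mult_left_le)
      qed (use K B E p in auto)
      finally show ?thesis by (simp add: mult_ac)
    qed
    \<comment> \<open>The telescoping runs over squares of the operators, so reaching
      \<open>f\<close> from the square at level \<open>j\<close> leaves two errors. Both are already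
      of size \<open>p ^ j\<close> and require no gain from the moments.\<close>
    have "\<Phi> f = \<Phi> (\<lambda>x. f x - P j f x) + \<Phi> (P j (\<lambda>x. f x - P j f x)) + \<Phi> (P j (P j f))"
    proof -
      have "P j (\<lambda>x. f x - P j f x) = (\<lambda>x. P j f x - P j (P j f) x)"
        unfolding P_def by (rule ext, rule quasi_diff[OF f quasi_bounded_borel[OF f]])
      then show ?thesis
        using \<Phi>_diff[OF f P_bb[OF f]] \<Phi>_diff[OF P_bb[OF f] P_bb[OF P_bb[OF f]]] by simp
    qed
    moreover have "\<Phi> (P j (P j f)) = \<Phi> (P 0 (P 0 f))
        + (\<Sum>i<j. \<Phi> (P (Suc i) (P (Suc i) f)) - \<Phi> (P i (P i f)))"
      by (subst sum_lessThan_telescope) simp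
    ultimately have "\<bar>\<Phi> f\<bar> \<le> \<bar>\<Phi> (\<lambda>x. f x - P j f x)\<bar> + \<bar>\<Phi> (P j (\<lambda>x. f x - P j f x))\<bar>
        + \<bar>\<Phi> (P 0 (P 0 f))\<bar> + \<bar>\<Sum>i<j. \<Phi> (P (Suc i) (P (Suc i) f)) - \<Phi> (P i (P i f))\<bar>"
      by linarith
    moreover have "\<bar>\<Phi> (\<lambda>x. f x - P j f x)\<bar> \<le> B * E * p ^ j * Nw" by (rule \<Phi>_bound[OF err])
    moreover have "\<bar>\<Phi> (P j (\<lambda>x. f x - P j f x))\<bar> \<le> K * (B * E * p ^ j)" using \<Phi>P[OF err, of j j] by simp
    moreover have "\<bar>\<Phi> (P 0 (P 0 f))\<bar> \<le> K * (binsum * mass * B) * p ^ j"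
    proof -
      have "\<bar>\<Phi> (P 0 (P 0 f))\<bar> \<le> K * (binsum * mass * B) * d ^ j"
        using \<Phi>P[OF P_bb[OF f], of 0] by simp
      also have "\<dots> \<le> K * (binsum * mass * B) * p ^ j"
        using K binsum_nonneg mass_nonneg B d by (intro mult_left_mono power_mono) auto
      finally show ?thesis .
    qed
    moreover have "\<bar>\<Sum>i<j. \<Phi> (P (Suc i) (P (Suc i) f)) - \<Phi> (P i (P i f))\<bar>
        \<le> 4 * K * E / d * B * (p ^ j * (d / (p - d)))"
    proof -
      have "\<bar>\<Sum>i<j. \<Phi> (P (Suc i) (P (Suc i) f)) - \<Phi> (P i (P i f))\<bar>
          \<le> (\<Sum>i<j. 4 * K * E / d * B * (p ^ i * d ^ (j - i)))"
        by (intro order_trans[OF sum_abs] sum_mono step) auto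
      also have "\<dots> = 4 * K * E / d * B * (\<Sum>i<j. p ^ i * d ^ (j - i))" by (simp only: sum_distrib_left)
      also have "\<dots> \<le> 4 * K * E / d * B * (p ^ j * (d / (p - d)))"
        using K E B d by (intro mult_left_mono geometric_convolution_bound) auto
      finally show ?thesis .
    qed
    ultimately have "\<bar>\<Phi> f\<bar> \<le> B * E * p ^ j * Nw + K * (B * E * p ^ j) + K * (binsum * mass * B) * p ^ j
        + 4 * K * E / d * B * (p ^ j * (d / (p - d)))" by linarith
    also have "\<dots> = C * B * p ^ j" by (simp add: C_def algebra_simps)
    finally show ?thesis by (simp add: \<Phi>_def)
  qed
  moreover have "0 \<le> C"
    using K E Nw binsum_nonneg mass_nonneg d p by (simp add: C_def)
  ultimately show thesis using that unfolding p_def by blast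
qed

end

section \<open>Synthesis from wavelet coefficients\<close>

lemma diffk_scale: "diffk k h (\<lambda>x. f (c *\<^sub>R x)) x = diffk k (c *\<^sub>R h) f (c *\<^sub>R x)"
  by (induction k arbitrary: x) (simp_all add: diffk_Suc scaleR_add_right scaleR_diff_right)

lemma diffk_sum: "diffk k h (\<lambda>x. \<Sum>l\<in>A. f l x) x = (\<Sum>l\<in>A. diffk k h (f l) x)"
  by (induction k arbitrary: x) (simp_all add: diffk_Suc sum_subtractf)

lemma diffk_diff: "diffk k h (\<lambda>x. f x - g x) x = diffk k h f x - diffk k h g x"
  by (induction k arbitrary: x) (simp_all add: diffk_Suc)

lemma diffk_suminf:
  assumes "\<And>x. summable (\<lambda>j. g j x)"
  shows "summable (\<lambda>j. diffk k h (g j) x) \<and>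
    diffk k h (\<lambda>x. \<Sum>j. g j x) x = (\<Sum>j. diffk k h (g j) x)"
  by (induction k arbitrary: x) (auto simp: diffk_Suc assms suminf_diff summable_diff)

section \<open>Sums over integer translates of one generator\<close>

lemma finite_int_vec_box: "finite {k :: int^'n. \<forall>i. \<bar>k $ i\<bar> \<le> N}"
proof -
  have "{k :: int^'n. \<forall>i. \<bar>k $ i\<bar> \<le> N} \<subseteq> vec_lambda ` (PiE UNIV (\<lambda>_. {-N..N}))"
  proof
    fix k :: "int^'n" assume "k \<in> {k. \<forall>i. \<bar>k $ i\<bar> \<le> N}"
    then have "(\<lambda>i. k $ i) \<in> PiE UNIV (\<lambda>_. {-N..N})" by (auto simp: abs_le_iff minus_le_iff)
    moreover have "k = vec_lambda (\<lambda>i. k $ i)" by simp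
    ultimately show "k \<in> vec_lambda ` (PiE UNIV (\<lambda>_. {-N..N}))" by blast
  qed
  then show ?thesis by (rule finite_subset) (intro finite_imageI finite_PiE, auto)
qed

text \<open>Subtracting the integer part of \<open>x\<close> moves all these labels into one fixed
  box, which makes the count uniform in \<open>x\<close>.\<close>

lemma lattice_points_ball:
  fixes R :: real
  shows "\<exists>N. \<forall>x::real^'n. finite {k. norm (x - ivec k) \<le> R} \<and> card {k. norm (x - ivec k) \<le> R} \<le> N"
proof -
  let ?B = "{k :: int^'n. \<forall>i. \<bar>k $ i\<bar> \<le> \<lceil>R\<rceil> + 1}"
  have B: "finite ?B" by (rule finite_int_vec_box)
  have "finite {k. norm (x - ivec k) \<le> R} \<and> card {k. norm (x - ivec k) \<le> R} \<le> card ?B" for x :: "real^'n"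
  proof -
    define z :: "int^'n" where "z = (\<chi> i. \<lfloor>x $ i\<rfloor>)"
    let ?A = "{k. norm (x - ivec k) \<le> R}"
    have "(\<lambda>k. k - z) ` ?A \<subseteq> ?B"
    proof clarify
      fix k i assume "norm (x - ivec k) \<le> R"
      then have "\<bar>x $ i - real_of_int (k $ i)\<bar> \<le> R"
        using component_le_norm_cart[of "x - ivec k" i] by (simp add: ivec_def)
      then show "\<bar>(k - z) $ i\<bar> \<le> \<lceil>R\<rceil> + 1" unfolding z_def by simp linarith
    qed
    moreover have "inj_on (\<lambda>k. k - z) ?A" by (auto simp: inj_on_def)
    ultimately show ?thesis using B card_inj_on_le inj_on_finite by blast
  qed
  then show ?thesis by blast
qed

lemma finite_lattice_points_ball: "finite {k. norm (x - ivec k) \<le> R}"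
  using lattice_points_ball by blast

text \<open>The coefficient family may be infinite. With \<open>R\<close> a support radius of
  \<open>w\<close>, the restriction to nearby labels makes each value a finite sum without changing
  it.\<close>

definition lattice_sum :: "real \<Rightarrow> (real^'n \<Rightarrow> real) \<Rightarrow> (int^'n \<Rightarrow> real) \<Rightarrow> real^'n \<Rightarrow> real" where
  "lattice_sum R w d x = (\<Sum>k | norm (x - ivec k) \<le> R. d k * w (x - ivec k))"

lemma lattice_sum_eq:
  assumes "finite K" "\<And>k. norm (x - ivec k) \<le> R \<Longrightarrow> k \<in> K" "\<And>x. R < norm x \<Longrightarrow> w x = 0"
  shows "lattice_sum R w d x = (\<Sum>k\<in>K. d k * w (x - ivec k))"
  unfolding lattice_sum_def using assms by (intro sum.mono_neutral_left) (auto simp: not_le)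

lemma continuous_on_lattice_sum:
  assumes "continuous_on UNIV w" "\<And>x. R < norm x \<Longrightarrow> w x = 0"
  shows "continuous_on UNIV (lattice_sum R w d)"
proof -
  have "isCont (lattice_sum R w d) a" for a
  proof -
    let ?K = "{k. norm (a - ivec k) \<le> R + 1}"
    have "lattice_sum R w d x = (\<Sum>k\<in>?K. d k * w (x - ivec k))" if "x \<in> ball a 1" for x
    proof (rule lattice_sum_eq[OF finite_lattice_points_ball _ assms(2)])
      fix k assume "norm (x - ivec k) \<le> R"
      then show "k \<in> ?K" using that norm_triangle_ineq[of "a - x" "x - ivec k"] by (auto simp: dist_norm)
    qed
    moreover have "continuous_on UNIV (\<lambda>x. \<Sum>k\<in>?K. d k * w (x - ivec k))"
      by (intro continuous_intros continuous_on_compose2[OF assms(1)]) auto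
    ultimately have "continuous_on (ball a 1) (lattice_sum R w d)"
      by (metis (no_types, lifting) continuous_on_cong continuous_on_subset subset_UNIV)
    then show ?thesis by (simp add: continuous_on_eq_continuous_at)
  qed
  then show ?thesis by (simp add: continuous_at_imp_continuous_on)
qed

text \<open>Overlap is bounded: at most \<open>N\<close> translates matter at a point. For
  \<open>norm h \<le> 1\<close> the difference falls on each smooth translate; for longer steps the
  sup bound times \<open>2 ^ m\<close> suffices.\<close>

lemma lattice_sum_bounds:
  fixes w :: "real^'n \<Rightarrow> real"
  assumes w: "Ck m w" "\<And>x. R < norm x \<Longrightarrow> w x = 0"
  obtains C where "0 \<le> C"
    "\<And>d D x. (\<And>k. \<bar>d k\<bar> \<le> D) \<Longrightarrow> \<bar>lattice_sum R w d x\<bar> \<le> C * D"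
    "\<And>d D h x. (\<And>k. \<bar>d k\<bar> \<le> D) \<Longrightarrow> \<bar>diffk m h (lattice_sum R w d) x\<bar> \<le> C * D * min 1 (norm h ^ m)"
proof -
  obtain M where M: "0 \<le> M" "\<And>x. \<bar>w x\<bar> \<le> M"
    using bounded_if_compact_support[OF Ck_imp_continuous[OF w(1)] w(2)] by blast
  obtain M0 where M0: "Ck_bound m M0 w"
    using Ck_bound_if_compact_support[OF w] by blast
  define M' where "M' = max M0 0"
  have M': "0 \<le> M'" "Ck_bound m M' w" using Ck_bound_mono[OF M0, of M'] by (auto simp: M'_def)
  \<comment> \<open>The enlargement by \<open>m\<close> lets one index set serve all nodes of an
    \<open>m\<close>-th difference with step of norm at most 1.\<close>
  obtain N where N: "\<And>x::real^'n. card {k. norm (x - ivec k) \<le> R + real m} \<le> N"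
    using lattice_points_ball[of "R + real m"] by blast
  define C1 where "C1 = real N * M"
  define C2 where "C2 = real N * (M' * real CARD('n) ^ m)"
  have C12: "0 \<le> C1" "0 \<le> C2" using M(1) M'(1) by (auto simp: C1_def C2_def)
  have bound: "\<bar>\<Sum>k | norm (x - ivec k) \<le> R + real m. d k * v k\<bar> \<le> real N * (D * V)"
    if d: "\<And>k. \<bar>d k\<bar> \<le> D" and v: "\<And>k. \<bar>v k\<bar> \<le> V" for d D V and v :: "int^'n \<Rightarrow> real" and x :: "real^'n"
  proof -
    have D: "0 \<le> D" "0 \<le> V" using d v abs_ge_zero order_trans by blast+
    let ?A = "{k. norm (x - ivec k) \<le> R + real m}"
    have "\<bar>\<Sum>k\<in>?A. d k * v k\<bar> \<le> (\<Sum>k\<in>?A. D * V)"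
      unfolding abs_mult[symmetric]
      by (intro order_trans[OF sum_abs] sum_mono) (auto simp: abs_mult intro!: mult_mono d v D)
    also have "\<dots> \<le> real N * (D * V)" using N[of x] D by (auto intro!: mult_right_mono)
    finally show ?thesis .
  qed
  have b1: "\<bar>lattice_sum R w d x\<bar> \<le> C1 * D" if d: "\<And>k. \<bar>d k\<bar> \<le> D" for d D x
  proof -
    have "lattice_sum R w d x = (\<Sum>k | norm (x - ivec k) \<le> R + real m. d k * w (x - ivec k))"
      by (rule lattice_sum_eq[OF finite_lattice_points_ball _ w(2)]) auto
    then show ?thesis using bound[OF d, where v = "\<lambda>k. w (x - ivec k)" and V = M and x = x] M(2) by (simp add: C1_def mult_ac)
  qed
  have b2: "\<bar>diffk m h (lattice_sum R w d) x\<bar> \<le> (2 ^ m * C1 + C2) * D * min 1 (norm h ^ m)"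
    if d: "\<And>k. \<bar>d k\<bar> \<le> D" for d D h x
  proof (cases "norm h \<le> 1")
    case True
    have D: "0 \<le> D" using d abs_ge_zero order_trans by blast
    let ?K = "{k. norm (x - ivec k) \<le> R + real m}"
    have "diffk m h (lattice_sum R w d) x
        = (\<Sum>r\<le>m. (-1) ^ (m + r) * real (m choose r) *
            (\<Sum>k\<in>?K. d k * w (x + (real r - real m / 2) *\<^sub>R h - ivec k)))"
      unfolding diffk_expand
    proof (intro sum.cong refl arg_cong2[where f = "(*)"] lattice_sum_eq[OF finite_lattice_points_ball _ w(2)])
      fix r k assume r: "r \<in> {..m}" and k: "norm (x + (real r - real m / 2) *\<^sub>R h - ivec k) \<le> R"
      define t where "t = (real r - real m / 2) *\<^sub>R h"
      have "\<bar>real r - real m / 2\<bar> * norm h \<le> real m * 1" using r True by (intro mult_mono) auto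
      then have "norm t \<le> real m" by (simp add: t_def)
      moreover have "x - ivec k = (x + t - ivec k) - t" by simp
      ultimately show "k \<in> ?K"
        using k norm_triangle_ineq4[of "x + t - ivec k" t] unfolding t_def[symmetric] mem_Collect_eq
        by (smt (verit))
    qed
    also have "\<dots> = (\<Sum>r\<le>m. \<Sum>k\<in>?K. d k *
        ((-1) ^ (m + r) * real (m choose r) * w (x - ivec k + (real r - real m / 2) *\<^sub>R h)))"
      unfolding sum_distrib_left by (intro sum.cong refl) (simp add: algebra_simps)
    also have "\<dots> = (\<Sum>k\<in>?K. d k * diffk m h w (x - ivec k))"
      unfolding diffk_expand sum_distrib_left by (rule sum.swap)
    also have "\<bar>\<dots>\<bar> \<le> real N * (D * (M' * (real CARD('n) * norm h) ^ m))"
      by (rule bound[OF d diffk_bound_Ck[OF w(1) M'(2)]])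
    also have "\<dots> = C2 * D * norm h ^ m" by (simp add: C2_def power_mult_distrib mult_ac)
    also have "\<dots> \<le> (2 ^ m * C1 + C2) * D * norm h ^ m"
      using C12 D by (intro mult_right_mono) auto
    also have "norm h ^ m = min 1 (norm h ^ m)" using True power_le_one[of "norm h" m] by simp
    finally show ?thesis .
  next
    case False
    have D: "0 \<le> D" using d abs_ge_zero order_trans by blast
    have "\<bar>diffk m h (lattice_sum R w d) x\<bar> \<le> 2 ^ m * (C1 * D)"
      by (rule diffk_bound_sup) (rule b1[OF d])
    also have "\<dots> \<le> (2 ^ m * C1 + C2) * D" using C12 D by (simp add: algebra_simps)
    also have "\<dots> = (2 ^ m * C1 + C2) * D * min 1 (norm h ^ m)"
      using False one_le_power[of "norm h" m] by (simp add: min_def)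
    finally show ?thesis .
  qed
  have "\<bar>lattice_sum R w d x\<bar> \<le> (2 ^ m * C1 + C2) * D" if d: "\<And>k. \<bar>d k\<bar> \<le> D" for d D x
  proof -
    have D: "0 \<le> D" using d abs_ge_zero order_trans by blast
    have "C1 * 1 \<le> C1 * 2 ^ m" by (rule mult_left_mono) (use C12 in auto)
    then have "C1 * D \<le> (2 ^ m * C1 + C2) * D"
      using C12 D by (intro mult_right_mono) (auto simp: mult_ac)
    then show ?thesis using b1[of d D x, OF d] by linarith
  qed
  with b2 C12 show thesis by (intro that[of "2 ^ m * C1 + C2"]) auto
qed

text \<open>The sum is split where \<open>2 ^ j * y\<close> passes 1. Finer scales use the bound 1
  and give the tail of a geometric series; coarser scales use the \<open>m\<close>-th power, and
  \<open>s < m\<close> makes their sum dominated by the splitting scale. Both parts are of size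
  \<open>y powr s\<close>.\<close>

lemma scale_sum_bound:
  fixes s :: real
  assumes s: "0 < s" "s < real m"
  obtains C where "0 \<le> C" "\<And>y. 0 < y \<Longrightarrow> y \<le> 1 \<Longrightarrow>
    summable (\<lambda>j. (2 powr (-s)) ^ j * min 1 ((2 ^ j * y) ^ m)) \<and>
    (\<Sum>j. (2 powr (-s)) ^ j * min 1 ((2 ^ j * y) ^ m)) \<le> C * y powr s"
proof -
  define p where "p = 2 powr (-s)"
  define d where "d = (1/2::real) ^ m"
  have d_powr: "d = 2 powr (- real m)"
    by (simp add: d_def powr_minus powr_realpow power_one_over field_simps)
  have d: "0 < d" "d < p" unfolding d_powr p_def using s by auto
  have p: "0 < p" "p < 1" using s by (auto simp: p_def powr_less_one)
  have "summable (\<lambda>j. p ^ j * min 1 ((2 ^ j * y) ^ m)) \<and>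
     (\<Sum>j. p ^ j * min 1 ((2 ^ j * y) ^ m)) \<le> (1 / (1 - p) + 1 / (p - d)) * y powr s"
    if y: "0 < y" "y \<le> 1" for y
  proof -
    let ?a = "\<lambda>j. p ^ j * min 1 ((2 ^ j * y) ^ m)"
    have a0: "0 \<le> ?a j" for j using p y by auto
    have ap: "?a j \<le> p ^ j" for j using p by (simp add: mult_left_le)
    have sp: "summable (\<lambda>j. p ^ j)" using p by (simp add: summable_geometric)
    have sa: "summable ?a" by (rule summable_comparison_test'[OF sp, of 0]) (use a0 ap in auto)
    \<comment> \<open>Since \<open>y \<le> 1\<close>, this \<open>n\<close> is positive, and
      minimality gives \<open>y \<le> (1/2) ^ J\<close> for its predecessor \<open>J\<close>. Thus
      \<open>y\<close> is comparable to \<open>(1/2) ^ n\<close> from both sides.\<close>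
    define n where "n = (LEAST n. (1/2) ^ n < y)"
    have n: "(1/2) ^ n < y"
      unfolding n_def by (rule LeastI_ex) (use real_arch_pow_inv[OF y(1), of "1/2"] in auto)
    have "n \<noteq> 0"
    proof
      assume "n = 0"
      with n y show False by simp
    qed
    then obtain J where J: "n = Suc J" by (cases n) auto
    have yJ: "y \<le> (1/2) ^ J" using not_less_Least[of J "\<lambda>n. (1/2) ^ n < y"] J by (simp add: n_def)
    have pn: "p ^ n \<le> y powr s"
    proof -
      have "p ^ n = ((1/2) ^ n) powr s"
        by (simp add: p_def powr_minus powr_divide inverse_eq_divide power_one_over
            powr_powr mult.commute flip: powr_realpow)
      also have "\<dots> \<le> y powr s" using n s by (intro powr_mono2) auto
      finally show ?thesis .
    qed
    have "suminf ?a = (\<Sum>j. ?a (j + n)) + (\<Sum>j<n. ?a j)" by (rule suminf_split_initial_segment[OF sa])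
    also have "(\<Sum>j. ?a (j + n)) \<le> (\<Sum>j. p ^ (j + n))"
      by (intro suminf_le ap summable_ignore_initial_segment[OF sa] summable_ignore_initial_segment[OF sp])
    also have "(\<Sum>j. p ^ (j + n)) = p ^ n * (1 / (1 - p))"
      using p suminf_mult2[OF sp, of "p ^ n"] by (simp add: power_add suminf_geometric mult_ac)
    also have "(\<Sum>j<n. ?a j) \<le> (\<Sum>j<n. (p ^ j * d ^ (n - j)) / d)"
    proof (rule sum_mono)
      fix j assume "j \<in> {..<n}"
      then have jJ: "j \<le> J" using J by auto
      have "2 ^ j * y \<le> 2 ^ j * (1/2) ^ J" using yJ by simp
      also have "\<dots> = (1/2) ^ (J - j)" using jJ by (simp add: power_diff power_one_over)
      finally have "(2 ^ j * y) ^ m \<le> ((1/2) ^ (J - j)) ^ m" using y by (intro power_mono) auto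
      also have "\<dots> = d ^ (J - j)" by (simp add: d_def mult.commute flip: power_mult)
      also have "\<dots> = d ^ (n - j) / d" using J jJ d by (simp add: Suc_diff_le)
      finally have "min 1 ((2 ^ j * y) ^ m) \<le> d ^ (n - j) / d" by linarith
      then show "?a j \<le> (p ^ j * d ^ (n - j)) / d" using p by (simp add: mult_left_mono flip: times_divide_eq_right)
    qed
    also have "\<dots> = (\<Sum>j<n. p ^ j * d ^ (n - j)) / d" by (simp add: sum_divide_distrib)
    also have "\<dots> \<le> (p ^ n * (d / (p - d))) / d"
      using d by (intro divide_right_mono geometric_convolution_bound) auto
    also have "\<dots> = p ^ n * (1 / (p - d))" using d by simp
    also have "p ^ n * (1 / (1 - p)) + p ^ n * (1 / (p - d)) = p ^ n * (1 / (1 - p) + 1 / (p - d))"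
      by (simp add: algebra_simps)
    also have "\<dots> \<le> y powr s * (1 / (1 - p) + 1 / (p - d))"
      using p d by (intro mult_right_mono pn) auto
    finally show ?thesis using sa by (simp add: mult.commute)
  qed
  moreover have "0 \<le> 1 / (1 - p) + 1 / (p - d)" using p d by auto
  ultimately show thesis using that unfolding p_def by blast
qed

text \<open>Geometric decay in sup norm gives uniform convergence, hence continuity, and lets
  differences pass through the series. Each piece is smooth at its own scale \<open>2^-j\<close>, so
  the difference bounds add up as in \<open>scale_sum_bound\<close>.\<close>

lemma multiscale_sum_bounds:
  fixes s :: real
  assumes s: "0 < s" "s < real m"
  obtains C where "0 \<le> C" "\<And>A (g :: nat \<Rightarrow> real^'n \<Rightarrow> real). 0 \<le> A \<Longrightarrow> (\<forall>j. continuous_on UNIV (g j)) \<Longrightarrow>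
      (\<forall>j x. \<bar>g j x\<bar> \<le> A * (2 powr (-s)) ^ j) \<Longrightarrow>
      (\<forall>j h x. \<bar>diffk m h (g j) x\<bar> \<le> A * (2 powr (-s)) ^ j * min 1 ((2 ^ j * norm h) ^ m)) \<Longrightarrow>
      continuous_on UNIV (\<lambda>x. \<Sum>j. g j x) \<and> (\<forall>x. \<bar>\<Sum>j. g j x\<bar> \<le> C * A) \<and>
      (\<forall>h x. 0 < norm h \<longrightarrow> norm h \<le> 1 \<longrightarrow> \<bar>diffk m h (\<lambda>x. \<Sum>j. g j x) x\<bar> \<le> C * A * norm h powr s)"
proof -
  obtain C where C: "0 \<le> C" "\<And>y. 0 < y \<Longrightarrow> y \<le> 1 \<Longrightarrow>
    summable (\<lambda>j. (2 powr (-s)) ^ j * min 1 ((2 ^ j * y) ^ m)) \<and>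
    (\<Sum>j. (2 powr (-s)) ^ j * min 1 ((2 ^ j * y) ^ m)) \<le> C * y powr s"
    by (rule scale_sum_bound[OF s], rule that)
  define p where "p = 2 powr (-s)"
  have p: "0 < p" "p < 1" using s by (auto simp: p_def powr_less_one)
  define C' where "C' = C + 1 / (1 - p)"
  have C': "C \<le> C'" "1 / (1 - p) \<le> C'" using C(1) p by (auto simp: C'_def)
  have "continuous_on UNIV (\<lambda>x. \<Sum>j. g j x) \<and> (\<forall>x. \<bar>\<Sum>j. g j x\<bar> \<le> C' * A) \<and>
      (\<forall>h x. 0 < norm h \<longrightarrow> norm h \<le> 1 \<longrightarrow> \<bar>diffk m h (\<lambda>x. \<Sum>j. g j x) x\<bar> \<le> C' * A * norm h powr s)"
    if A: "0 \<le> A" and "\<forall>j. continuous_on UNIV (g j)"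
      and "\<forall>j x. \<bar>g j x\<bar> \<le> A * p ^ j"
      and "\<forall>j h x. \<bar>diffk m h (g j) x\<bar> \<le> A * p ^ j * min 1 ((2 ^ j * norm h) ^ m)"
    for A and g :: "nat \<Rightarrow> real^'n \<Rightarrow> real"
  proof (intro conjI allI impI)
    have cont: "\<And>j. continuous_on UNIV (g j)" and b: "\<And>j x. \<bar>g j x\<bar> \<le> A * p ^ j"
      and db: "\<And>j h x. \<bar>diffk m h (g j) x\<bar> \<le> A * p ^ j * min 1 ((2 ^ j * norm h) ^ m)"
      using that by blast+
    have sp: "summable (\<lambda>j. A * p ^ j)" using p by (intro summable_mult) (simp add: summable_geometric)
    have sg: "summable (\<lambda>j. \<bar>g j x\<bar>)" for x
      by (rule summable_comparison_test'[OF sp, of 0]) (use b in auto)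
    have "uniform_limit UNIV (\<lambda>n x. \<Sum>i<n. g i x) (\<lambda>x. \<Sum>j. g j x) sequentially"
      by (rule Weierstrass_m_test[OF _ sp]) (use b in auto)
    then show "continuous_on UNIV (\<lambda>x. \<Sum>j. g j x)"
      by (rule uniform_limit_theorem[rotated]) (auto intro!: always_eventually continuous_intros cont)
    show "\<bar>\<Sum>j. g j x\<bar> \<le> C' * A" for x
    proof -
      have "\<bar>\<Sum>j. g j x\<bar> \<le> (\<Sum>j. \<bar>g j x\<bar>)" by (rule summable_rabs[OF sg])
      also have "\<dots> \<le> (\<Sum>j. A * p ^ j)" by (rule suminf_le[OF b sg sp])
      also have "\<dots> = A * (1 / (1 - p))"
        using p by (subst suminf_mult) (auto simp: summable_geometric suminf_geometric)
      also have "\<dots> \<le> C' * A" using mult_left_mono[OF C'(2) A] by (simp add: mult_ac)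
      finally show ?thesis .
    qed
    show "\<bar>diffk m h (\<lambda>x. \<Sum>j. g j x) x\<bar> \<le> C' * A * norm h powr s" if h: "0 < norm h" "norm h \<le> 1" for h x
    proof -
      let ?a = "\<lambda>j. p ^ j * min 1 ((2 ^ j * norm h) ^ m)"
      have sa': "summable ?a" and le: "suminf ?a \<le> C * norm h powr s"
        using C(2)[OF h] unfolding p_def by blast+
      have sa: "summable (\<lambda>j. A * ?a j)" by (rule summable_mult[OF sa'])
      have db': "\<bar>diffk m h (g j) x\<bar> \<le> A * ?a j" for j using db[of h j x] by (simp add: mult.assoc)
      have sd: "summable (\<lambda>j. \<bar>diffk m h (g j) x\<bar>)"
        by (rule summable_comparison_test'[OF sa, of 0]) (use db' in auto)
      have "\<And>x. summable (\<lambda>j. g j x)" by (rule summable_rabs_cancel[OF sg])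
      from diffk_suminf[of g m h x, OF this] have "diffk m h (\<lambda>x. \<Sum>j. g j x) x = (\<Sum>j. diffk m h (g j) x)" by blast
      also have "\<bar>\<dots>\<bar> \<le> (\<Sum>j. \<bar>diffk m h (g j) x\<bar>)" by (rule summable_rabs[OF sd])
      also have "\<dots> \<le> (\<Sum>j. A * ?a j)" by (rule suminf_le[OF db' sd sa])
      also have "\<dots> = A * suminf ?a" by (rule suminf_mult[OF sa'])
      also have "\<dots> \<le> A * (C * norm h powr s)" by (rule mult_left_mono[OF le A])
      also have "\<dots> \<le> A * (C' * norm h powr s)" by (intro mult_left_mono mult_right_mono C' A) auto
      finally show ?thesis by (simp add: mult_ac)
    qed
  qed
  moreover have "0 \<le> C'" using C(1) C' by linarith
  ultimately show thesis using that[of C'] unfolding p_def by blast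
qed

section \<open>Wavelets of all types and their synthesis level by level\<close>

definition gen :: "(real^'n \<Rightarrow> real) \<Rightarrow> (nat \<Rightarrow> real^'n \<Rightarrow> real) \<Rightarrow> nat \<Rightarrow> real^'n \<Rightarrow> real" where
  "gen \<phi> \<psi> l = (if l = 0 then \<phi> else \<psi> l)"

definition gen_ind :: "nat \<Rightarrow> nat \<Rightarrow> nat set" where
  "gen_ind n j = (if j = 0 then {0} else {}) \<union> {1..2 ^ n - 1}"

lemma finite_gen_ind [simp]: "finite (gen_ind n j)"
  and gen_ind_le: "l \<in> gen_ind n j \<Longrightarrow> l \<le> 2 ^ n - 1"
  and one_in_gen_ind: "0 < n \<Longrightarrow> 1 \<in> gen_ind n j"
  using one_less_power[of "2::nat" n] by (auto simp: gen_ind_def split: if_splits)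

lemma card_gen_ind: "card (gen_ind n j) \<le> 2 ^ n"
proof -
  have "gen_ind n j \<subseteq> {..2 ^ n - 1}" using gen_ind_le by auto
  then show ?thesis using card_mono[of "{..2 ^ n - 1}" "gen_ind n j"] by simp
qed

lemma Omega_iff: "(l, j, k :: int^'n) \<in> Omega \<longleftrightarrow> l \<in> gen_ind CARD('n) j"
  by (auto simp: Omega_def gen_ind_def)

text \<open>One formula covers the scaling function as well, because type 0 occurs in
  \<open>Omega\<close> only at level 0, where the dilation and the normalising factor are
  trivial.\<close>

lemma wav_eq:
  assumes "(l, j, k :: int^'n) \<in> Omega"
  shows "wav \<phi> \<psi> (l, j, k) x = 2 powr (real j * real CARD('n) / 2) * gen \<phi> \<psi> l (2 ^ j *\<^sub>R x - ivec k)"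
  using assms by (auto simp: wav_def gen_def Omega_def)

locale wavelet_system =
  fixes \<phi> :: "real^'n \<Rightarrow> real" and \<psi> :: "nat \<Rightarrow> real^'n \<Rightarrow> real" and m L :: nat and R :: real
  assumes gen_Ck: "l \<le> 2 ^ CARD('n) - 1 \<Longrightarrow> Ck m (gen \<phi> \<psi> l)"
    and gen_support: "l \<le> 2 ^ CARD('n) - 1 \<Longrightarrow> R < norm x \<Longrightarrow> gen \<phi> \<psi> l x = 0"
    and gen_moments: "1 \<le> l \<Longrightarrow> l \<le> 2 ^ CARD('n) - 1 \<Longrightarrow> vanishing_moments L (gen \<phi> \<psi> l)"
    and orthonormal: "\<omega> \<in> Omega \<Longrightarrow> \<omega>' \<in> Omega \<Longrightarrow>
      (LINT x|lborel. wav \<phi> \<psi> \<omega> x * wav \<phi> \<psi> \<omega>' x) = (if \<omega> = \<omega>' then 1 else 0)"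
    and radius_nonneg: "0 \<le> R" and order_le: "m \<le> L"
begin

lemma gen_continuous: "l \<le> 2 ^ CARD('n) - 1 \<Longrightarrow> continuous_on UNIV (gen \<phi> \<psi> l)"
  by (rule Ck_imp_continuous[OF gen_Ck])

lemma wav_continuous:
  assumes "\<omega> \<in> Omega" shows "continuous_on UNIV (wav \<phi> \<psi> \<omega>)"
proof -
  obtain l j k where \<omega>: "\<omega> = (l, j, k)" by (cases \<omega>) auto
  with assms have "l \<le> 2 ^ CARD('n) - 1" using Omega_iff gen_ind_le by blast
  then show ?thesis
    unfolding \<omega> wav_eq[OF assms[unfolded \<omega>], abs_def]
    by (intro continuous_intros continuous_on_compose2[OF gen_continuous]) auto
qed

lemma wav_support:
  assumes "\<omega> \<in> Omega" "R + norm (ivec (snd (snd \<omega>))) < norm x" shows "wav \<phi> \<psi> \<omega> x = 0"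
proof -
  obtain l j k where \<omega>: "\<omega> = (l, j, k)" by (cases \<omega>) auto
  with assms have l: "l \<le> 2 ^ CARD('n) - 1" using Omega_iff gen_ind_le by blast
  have "1 * norm x \<le> 2 ^ j * norm x" by (intro mult_right_mono) auto
  then have "R < norm (2 ^ j *\<^sub>R x - ivec k)"
    using norm_triangle_ineq2[of "2 ^ j *\<^sub>R x" "ivec k"] assms(2) \<omega> by simp
  then show ?thesis using wav_eq[OF assms(1)[unfolded \<omega>]] gen_support[OF l] \<omega> by simp
qed

lemma wav_integrable: "\<omega> \<in> Omega \<Longrightarrow> integrable lborel (wav \<phi> \<psi> \<omega>)"
  by (rule integrable_compact_support[OF wav_continuous wav_support])

definition synth :: "(nat \<times> nat \<times> (int^'n) \<Rightarrow> real) \<Rightarrow> nat \<Rightarrow> real^'n \<Rightarrow> real" where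
  "synth c j x = (\<Sum>l\<in>gen_ind CARD('n) j. lattice_sum R (gen \<phi> \<psi> l)
     (\<lambda>k. 2 powr (real j * real CARD('n) / 2) * c (l, j, k)) (2 ^ j *\<^sub>R x))"

lemma synth_continuous: "continuous_on UNIV (synth c j)"
  unfolding synth_def[abs_def]
  by (intro continuous_on_sum continuous_on_compose2[OF continuous_on_lattice_sum]
      gen_continuous gen_support gen_ind_le continuous_intros) auto

lemma synth_eq:
  assumes "finite K" "\<And>k. norm (2 ^ j *\<^sub>R x - ivec k) \<le> R \<Longrightarrow> k \<in> K"
  shows "synth c j x = (\<Sum>l\<in>gen_ind CARD('n) j. \<Sum>k\<in>K. c (l, j, k) * wav \<phi> \<psi> (l, j, k) x)"
  unfolding synth_def
proof (intro sum.cong refl)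
  fix l assume l: "l \<in> gen_ind CARD('n) j"
  then have "wav \<phi> \<psi> (l, j, k) x = 2 powr (real j * real CARD('n) / 2) * gen \<phi> \<psi> l (2 ^ j *\<^sub>R x - ivec k)" for k
    using wav_eq Omega_iff by blast
  then show "lattice_sum R (gen \<phi> \<psi> l) (\<lambda>k. 2 powr (real j * real CARD('n) / 2) * c (l, j, k)) (2 ^ j *\<^sub>R x)
      = (\<Sum>k\<in>K. c (l, j, k) * wav \<phi> \<psi> (l, j, k) x)"
    using lattice_sum_eq[OF assms(1), of "2 ^ j *\<^sub>R x" R "gen \<phi> \<psi> l"] assms(2) gen_support[OF gen_ind_le[OF l]]
    by (simp add: mult_ac)
qed

text \<open>Level \<open>j\<close> is a finite sum of lattice sums composed with the dilation by
  \<open>2 ^ j\<close>; this turns the step \<open>h\<close> into \<open>2 ^ j h\<close>.\<close>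

lemma synth_bounds:
  fixes s :: real
  obtains C where "0 \<le> C" "\<And>c \<epsilon>. 0 \<le> \<epsilon> \<Longrightarrow>
    (\<forall>l j k. (l, j, k) \<in> Omega \<longrightarrow> 2 powr (real j * real CARD('n) / 2) * \<bar>c (l, j, k)\<bar> \<le> \<epsilon> * (2 powr (-s)) ^ j) \<Longrightarrow>
    (\<forall>j x. \<bar>synth c j x\<bar> \<le> C * \<epsilon> * (2 powr (-s)) ^ j) \<and>
    (\<forall>j h x. \<bar>diffk m h (synth c j) x\<bar> \<le> C * \<epsilon> * (2 powr (-s)) ^ j * min 1 ((2 ^ j * norm h) ^ m))"
proof -
  define P where "P l C \<longleftrightarrow>
     (\<forall>d D x. (\<forall>k. \<bar>d k\<bar> \<le> D) \<longrightarrow> \<bar>lattice_sum R (gen \<phi> \<psi> l) d x\<bar> \<le> C * D) \<and>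
     (\<forall>d D h x. (\<forall>k. \<bar>d k\<bar> \<le> D) \<longrightarrow> \<bar>diffk m h (lattice_sum R (gen \<phi> \<psi> l) d) x\<bar> \<le> C * D * min 1 (norm h ^ m))"
    for l C
  have "\<exists>C. 0 \<le> C \<and> (l \<le> 2 ^ CARD('n) - 1 \<longrightarrow> P l C)" for l
  proof (cases "l \<le> 2 ^ CARD('n) - 1")
    case True
    show ?thesis
      unfolding P_def
      by (rule lattice_sum_bounds[OF gen_Ck[OF True] gen_support[OF True]], assumption) blast
  qed auto
  then obtain Cl where Cl0: "\<And>l. 0 \<le> Cl l" and P: "\<And>l. l \<le> 2 ^ CARD('n) - 1 \<Longrightarrow> P l (Cl l)" by metis
  have Cl1: "\<bar>lattice_sum R (gen \<phi> \<psi> l) d x\<bar> \<le> Cl l * D"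
    and Cl2: "\<bar>diffk m h (lattice_sum R (gen \<phi> \<psi> l) d) x\<bar> \<le> Cl l * D * min 1 (norm h ^ m)"
    if "l \<le> 2 ^ CARD('n) - 1" "\<And>k. \<bar>d k\<bar> \<le> D" for l d D h x
    using P[OF that(1)] that(2) unfolding P_def by simp_all
  define C where "C = (\<Sum>l\<le>2 ^ CARD('n) - 1. Cl l)"
  have C_ge: "(\<Sum>l\<in>gen_ind CARD('n) j. Cl l) \<le> C" for j
    unfolding C_def using gen_ind_le Cl0 by (intro sum_mono2) auto
  have "(\<forall>j x. \<bar>synth c j x\<bar> \<le> C * \<epsilon> * (2 powr (-s)) ^ j) \<and>
    (\<forall>j h x. \<bar>diffk m h (synth c j) x\<bar> \<le> C * \<epsilon> * (2 powr (-s)) ^ j * min 1 ((2 ^ j * norm h) ^ m))"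
    if \<epsilon>: "0 \<le> \<epsilon>" and
      c: "\<forall>l j k. (l, j, k) \<in> Omega \<longrightarrow> 2 powr (real j * real CARD('n) / 2) * \<bar>c (l, j, k)\<bar> \<le> \<epsilon> * (2 powr (-s)) ^ j"
    for c \<epsilon>
  proof (intro conjI allI)
    fix j h and x :: "real^'n"
    let ?D = "\<epsilon> * (2 powr (-s)) ^ j"
    have D: "0 \<le> ?D" using \<epsilon> by simp
    have c': "\<bar>2 powr (real j * real CARD('n) / 2) * c (l, j, k)\<bar> \<le> ?D" if "l \<in> gen_ind CARD('n) j" for l k
      using c that by (simp add: Omega_iff abs_mult)
    have "\<bar>synth c j x\<bar> \<le> (\<Sum>l\<in>gen_ind CARD('n) j. Cl l * ?D)"
      unfolding synth_def by (intro order_trans[OF sum_abs] sum_mono Cl1 gen_ind_le c')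
    also have "\<dots> \<le> C * ?D" unfolding sum_distrib_right[symmetric] by (rule mult_right_mono[OF C_ge D])
    finally show "\<bar>synth c j x\<bar> \<le> C * \<epsilon> * (2 powr (-s)) ^ j" by (simp add: mult.assoc)
    have "\<bar>diffk m h (synth c j) x\<bar> \<le> (\<Sum>l\<in>gen_ind CARD('n) j. Cl l * ?D * min 1 (norm ((2 ^ j :: real) *\<^sub>R h) ^ m))"
      unfolding synth_def[abs_def] diffk_sum diffk_scale
      by (intro order_trans[OF sum_abs] sum_mono Cl2 gen_ind_le c')
    also have "\<dots> = (\<Sum>l\<in>gen_ind CARD('n) j. Cl l) * (?D * min 1 ((2 ^ j * norm h) ^ m))"
      by (simp add: sum_distrib_right mult.assoc)
    also have "\<dots> \<le> C * (?D * min 1 ((2 ^ j * norm h) ^ m))"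
      by (rule mult_right_mono[OF C_ge]) (use D in auto)
    finally show "\<bar>diffk m h (synth c j) x\<bar> \<le> C * \<epsilon> * (2 powr (-s)) ^ j * min 1 ((2 ^ j * norm h) ^ m)"
      by (simp add: mult.assoc)
  qed
  moreover have "0 \<le> C" using Cl0 by (simp add: C_def sum_nonneg)
  ultimately show thesis using that by blast
qed

lemma synth_coef:
  assumes "\<omega> \<in> Omega"
  shows "(LINT x|lborel. synth c j x * wav \<phi> \<psi> \<omega> x) = (if j = fst (snd \<omega>) then c \<omega> else 0)"
proof -
  obtain l' j' k' where \<omega>: "\<omega> = (l', j', k')" by (cases \<omega>) auto
  let ?r = "R + norm (ivec k')" and ?G = "gen_ind CARD('n) j"
  \<comment> \<open>These labels include all whose level-\<open>j\<close> wavelets can be nonzero in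
    the ball of radius \<open>?r\<close>, which contains the support of
    \<open>wav \<phi> \<psi> \<omega>\<close>. Inserting \<open>k'\<close> guarantees the diagonal
    term when \<open>j = j'\<close>.\<close>
  define K where "K = insert k' {k :: int^'n. norm (0 - ivec k) \<le> R + 2 ^ j * ?r}"
  have K: "finite K" using finite_lattice_points_ball[of "0 :: real^'n"] unfolding K_def by auto
  have e: "synth c j x * wav \<phi> \<psi> \<omega> x
      = (\<Sum>l\<in>?G. \<Sum>k\<in>K. c (l, j, k) * (wav \<phi> \<psi> (l, j, k) x * wav \<phi> \<psi> \<omega> x))" for x
  proof (cases "norm x \<le> ?r")
    case True
    have "synth c j x = (\<Sum>l\<in>?G. \<Sum>k\<in>K. c (l, j, k) * wav \<phi> \<psi> (l, j, k) x)"
    proof (rule synth_eq[OF K])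
      fix k assume k: "norm (2 ^ j *\<^sub>R x - ivec k) \<le> R"
      have "norm (ivec k) \<le> norm (2 ^ j *\<^sub>R x - ivec k) + norm (2 ^ j *\<^sub>R x)"
        using norm_triangle_ineq4[of "2 ^ j *\<^sub>R x" "2 ^ j *\<^sub>R x - ivec k"] by simp
      also have "\<dots> \<le> R + 2 ^ j * ?r" using True k by (intro add_mono) auto
      finally show "k \<in> K" by (simp add: K_def)
    qed
    then show ?thesis by (simp add: sum_distrib_right mult.assoc)
  next
    case False
    then have "wav \<phi> \<psi> \<omega> x = 0" using wav_support[OF assms, of x] \<omega> by simp
    then show ?thesis by simp
  qed
  have i: "integrable lborel (\<lambda>x. c (l, j, k) * (wav \<phi> \<psi> (l, j, k) x * wav \<phi> \<psi> \<omega> x))" if "l \<in> ?G" for l k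
    by (intro integrable_mult_right integrable_compact_support[where R = ?r] continuous_intros wav_continuous)
      (use that wav_support[OF assms] assms \<omega> in \<open>auto simp: Omega_iff\<close>)
  have "(LINT x|lborel. synth c j x * wav \<phi> \<psi> \<omega> x)
      = (\<Sum>l\<in>?G. \<Sum>k\<in>K. c (l, j, k) * (LINT x|lborel. wav \<phi> \<psi> (l, j, k) x * wav \<phi> \<psi> \<omega> x))"
  proof -
    have "(LINT x|lborel. synth c j x * wav \<phi> \<psi> \<omega> x) = (\<Sum>l\<in>?G. LINT x|lborel.
        (\<Sum>k\<in>K. c (l, j, k) * (wav \<phi> \<psi> (l, j, k) x * wav \<phi> \<psi> \<omega> x)))"
      unfolding e by (intro Bochner_Integration.integral_sum Bochner_Integration.integrable_sum i)
    also have "\<dots> = (\<Sum>l\<in>?G. \<Sum>k\<in>K. LINT x|lborel. c (l, j, k) * (wav \<phi> \<psi> (l, j, k) x * wav \<phi> \<psi> \<omega> x))"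
      by (intro sum.cong refl Bochner_Integration.integral_sum i)
    finally show ?thesis by simp
  qed
  also have "\<dots> = (\<Sum>l\<in>?G. \<Sum>k\<in>K. if (l, j, k) = \<omega> then c \<omega> else 0)"
    by (intro sum.cong refl, subst orthonormal) (use assms in \<open>auto simp: Omega_iff\<close>)
  also have "\<dots> = (if j = j' then c \<omega> else 0)"
  proof (cases "j = j'")
    case True
    have l': "l' \<in> ?G" using assms \<omega> True by (simp add: Omega_iff)
    have "(\<Sum>l\<in>?G. \<Sum>k\<in>K. if (l, j, k) = \<omega> then c \<omega> else 0)
        = (\<Sum>l\<in>?G. if l = l' then c \<omega> else 0)"
      using K by (intro sum.cong refl) (auto simp: \<omega> True K_def)
    then show ?thesis using l' True by simp
  qed (auto simp: \<omega>)
  finally show ?thesis using \<omega> by simp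
qed

text \<open>The condition on \<open>c\<close> is a multiple of \<open>|I|^(s/n+1/2)\<close> as
  bound, written out with \<open>|I| = 2^(-jn)\<close>. The sup bounds of the levels, times the L^1
  norm of a wavelet, justify termwise integration, and orthonormality leaves only the level of
  \<open>\<omega>\<close>.\<close>

theorem synthesis:
  fixes s :: real
  assumes s: "0 < s" "s < real m"
  obtains C where "0 \<le> C" "\<And>c \<epsilon>. 0 \<le> \<epsilon> \<Longrightarrow>
    (\<forall>l j k. (l, j, k) \<in> Omega \<longrightarrow> 2 powr (real j * real CARD('n) / 2) * \<bar>c (l, j, k)\<bar> \<le> \<epsilon> * (2 powr (-s)) ^ j) \<Longrightarrow>
    \<exists>h. continuous_on UNIV h \<and> (\<forall>x. \<bar>h x\<bar> \<le> C * \<epsilon>) \<and>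
      (\<forall>v x. 0 < norm v \<longrightarrow> norm v \<le> 1 \<longrightarrow> \<bar>diffk m v h x\<bar> \<le> C * \<epsilon> * norm v powr s) \<and>
      (\<forall>\<omega>\<in>Omega. coef \<phi> \<psi> h \<omega> = c \<omega>)"
proof -
  obtain C1 where C1: "0 \<le> C1" "\<And>c \<epsilon>. 0 \<le> \<epsilon> \<Longrightarrow>
    (\<forall>l j k. (l, j, k) \<in> Omega \<longrightarrow> 2 powr (real j * real CARD('n) / 2) * \<bar>c (l, j, k)\<bar> \<le> \<epsilon> * (2 powr (-s)) ^ j) \<Longrightarrow>
    (\<forall>j x. \<bar>synth c j x\<bar> \<le> C1 * \<epsilon> * (2 powr (-s)) ^ j) \<and>
    (\<forall>j h x. \<bar>diffk m h (synth c j) x\<bar> \<le> C1 * \<epsilon> * (2 powr (-s)) ^ j * min 1 ((2 ^ j * norm h) ^ m))"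
    by (rule synth_bounds[where s = s], rule that)
  obtain C2 where C2: "0 \<le> C2" "\<And>A (g :: nat \<Rightarrow> real^'n \<Rightarrow> real). 0 \<le> A \<Longrightarrow> (\<forall>j. continuous_on UNIV (g j)) \<Longrightarrow>
      (\<forall>j x. \<bar>g j x\<bar> \<le> A * (2 powr (-s)) ^ j) \<Longrightarrow>
      (\<forall>j h x. \<bar>diffk m h (g j) x\<bar> \<le> A * (2 powr (-s)) ^ j * min 1 ((2 ^ j * norm h) ^ m)) \<Longrightarrow>
      continuous_on UNIV (\<lambda>x. \<Sum>j. g j x) \<and> (\<forall>x. \<bar>\<Sum>j. g j x\<bar> \<le> C2 * A) \<and>
      (\<forall>h x. 0 < norm h \<longrightarrow> norm h \<le> 1 \<longrightarrow> \<bar>diffk m h (\<lambda>x. \<Sum>j. g j x) x\<bar> \<le> C2 * A * norm h powr s)"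
    by (rule multiscale_sum_bounds[OF s], rule that)
  have "\<exists>h. continuous_on UNIV h \<and> (\<forall>x. \<bar>h x\<bar> \<le> C2 * C1 * \<epsilon>) \<and>
      (\<forall>v x. 0 < norm v \<longrightarrow> norm v \<le> 1 \<longrightarrow> \<bar>diffk m v h x\<bar> \<le> C2 * C1 * \<epsilon> * norm v powr s) \<and>
      (\<forall>\<omega>\<in>Omega. coef \<phi> \<psi> h \<omega> = c \<omega>)"
    if \<epsilon>: "0 \<le> \<epsilon>" and
      c: "\<forall>l j k. (l, j, k) \<in> Omega \<longrightarrow> 2 powr (real j * real CARD('n) / 2) * \<bar>c (l, j, k)\<bar> \<le> \<epsilon> * (2 powr (-s)) ^ j"
    for c \<epsilon>
  proof -
    let ?p = "2 powr (-s) :: real"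
    define A where "A = C1 * \<epsilon>"
    have A: "0 \<le> A" using C1 \<epsilon> by (simp add: A_def)
    have p: "0 < ?p" "?p < 1" using s by (auto simp: powr_less_one)
    have b: "\<bar>synth c j x\<bar> \<le> A * ?p ^ j"
      "\<bar>diffk m h (synth c j) x\<bar> \<le> A * ?p ^ j * min 1 ((2 ^ j * norm h) ^ m)" for j h x
      using C1(2)[OF \<epsilon> c] by (auto simp: A_def)
    define h where "h x = (\<Sum>j. synth c j x)" for x
    have h: "continuous_on UNIV h \<and> (\<forall>x. \<bar>h x\<bar> \<le> C2 * A) \<and>
      (\<forall>v x. 0 < norm v \<longrightarrow> norm v \<le> 1 \<longrightarrow> \<bar>diffk m v h x\<bar> \<le> C2 * A * norm v powr s)"
      unfolding h_def[abs_def] using C2(2)[OF A, of "synth c"] synth_continuous b by blast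
    have sp: "summable (\<lambda>j. A * ?p ^ j)" using p by (intro summable_mult) (simp add: summable_geometric)
    have sg: "summable (\<lambda>j. \<bar>synth c j x\<bar>)" for x
      by (rule summable_comparison_test'[OF sp, of 0]) (use b in auto)
    have "coef \<phi> \<psi> h \<omega> = c \<omega>" if \<omega>: "\<omega> \<in> Omega" for \<omega>
    proof -
      let ?w = "wav \<phi> \<psi> \<omega>"
      have bb: "bounded_borel (A * ?p ^ j) (synth c j)" for j
        unfolding bounded_borel_def using b(1) borel_measurable_continuous_onI[OF synth_continuous] by blast
      have i: "integrable lborel (\<lambda>x. synth c j x * ?w x)" for j
        by (rule integral_bounded_mult[OF bb wav_integrable[OF \<omega>]])
      have "bounded_borel (A * ?p ^ j) (\<lambda>x. \<bar>synth c j x\<bar>)" for j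
        using bb[of j] by (auto simp: bounded_borel_def)
      from integral_bounded_mult(2)[OF this integrable_abs[OF wav_integrable[OF \<omega>]]]
      have ib: "(LINT x|lborel. norm (synth c j x * ?w x)) \<le> A * ?p ^ j * (LINT x|lborel. \<bar>?w x\<bar>)" for j
        by (simp add: abs_mult)
      have "coef \<phi> \<psi> h \<omega> = (LINT x|lborel. (\<Sum>j. synth c j x * ?w x))"
        unfolding coef_def h_def
        by (intro Bochner_Integration.integral_cong refl suminf_mult2 summable_rabs_cancel[OF sg])
      also have "\<dots> = (\<Sum>j. LINT x|lborel. synth c j x * ?w x)"
      proof (rule integral_suminf[OF i])
        show "AE x in lborel. summable (\<lambda>j. norm (synth c j x * ?w x))"
          using sg by (auto simp: abs_mult intro!: summable_mult2)
        show "summable (\<lambda>j. LINT x|lborel. norm (synth c j x * ?w x))"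
          by (rule summable_comparison_test'[OF summable_mult2[OF sp], of 0]) (use ib in auto)
      qed
      also have "\<dots> = (\<Sum>j. if j = fst (snd \<omega>) then c \<omega> else 0)"
        by (simp only: synth_coef[OF \<omega>])
      also have "\<dots> = c \<omega>" using sums_single[of "fst (snd \<omega>)" "\<lambda>_. c \<omega>"] by (simp add: sums_iff)
      finally show ?thesis .
    qed
    with h show ?thesis by (intro exI[of _ h]) (simp add: A_def mult.assoc)
  qed
  then show thesis using C1(1) C2(1) by (intro that[of "C2 * C1"]) auto
qed

end

section \<open>Lipschitz norms, dyadic cubes and the distance formula\<close>

definition diff_order :: "real \<Rightarrow> nat" where "diff_order s = nat \<lfloor>s\<rfloor> + 1"

lemma diff_order_gt: "0 < s \<Longrightarrow> s < real (diff_order s)"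
  unfolding diff_order_def by linarith

lemma diff_order_le: "s < real L \<Longrightarrow> 0 < s \<Longrightarrow> diff_order s \<le> L"
  unfolding diff_order_def by linarith

text \<open>A real-valued substitute for the extended norm, with one constant for both of its parts.
  The two notions agree up to the factor 2 that arises from adding the parts.\<close>

definition holder_bound :: "real \<Rightarrow> real \<Rightarrow> (real^'n \<Rightarrow> real) \<Rightarrow> bool" where
  "holder_bound s B f \<longleftrightarrow> (\<forall>x. \<bar>f x\<bar> \<le> B) \<and>
     (\<forall>h x. 0 < norm h \<longrightarrow> norm h \<le> 1 \<longrightarrow> \<bar>diffk (diff_order s) h f x\<bar> \<le> B * norm h powr s)"

lemma holder_bound_nonneg: "holder_bound s B f \<Longrightarrow> 0 \<le> B"
  unfolding holder_bound_def using abs_ge_zero order_trans by blast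

lemma Lambda_norm_le_imp_holder_bound:
  fixes f :: "real^'n \<Rightarrow> real"
  assumes "Lambda_norm s f \<le> ennreal B" "0 \<le> B"
  shows "holder_bound s B f"
  unfolding holder_bound_def
proof (intro conjI allI impI)
  fix x
  have "ennreal \<bar>f x\<bar> \<le> sup_norm f" unfolding sup_norm_def by (rule SUP_upper) simp
  also have "\<dots> \<le> Lambda_norm s f" by (simp add: Lambda_norm_def)
  finally show "\<bar>f x\<bar> \<le> B" using assms by (metis ennreal_le_iff order_trans)
next
  fix h x :: "real^'n"
  assume h: "0 < norm h" "norm h \<le> 1"
  let ?d = "\<bar>diffk (diff_order s) h f x\<bar>" and ?y = "norm h"
  have "ennreal (?d / ?y powr s) = ennreal ?d / ennreal (?y powr s)"
    using h by (simp add: divide_ennreal)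
  also have "\<dots> \<le> Delta_sup (diff_order s) f x ?y / ennreal (?y powr s)"
    unfolding Delta_sup_def by (intro divide_right_mono_ennreal SUP_upper) simp
  also have "\<dots> \<le> (SUP y\<in>{0<..1}. Delta_sup (diff_order s) f x y / ennreal (y powr s))"
    by (rule SUP_upper) (use h in auto)
  also have "\<dots> \<le> (SUP x. SUP y\<in>{0<..1}. Delta_sup (diff_order s) f x y / ennreal (y powr s))"
    by (rule SUP_upper) simp
  also have "\<dots> \<le> Lambda_norm s f" by (simp add: Lambda_norm_def diff_order_def)
  finally have "?d / ?y powr s \<le> B" using assms by (metis ennreal_le_iff order_trans)
  then show "?d \<le> B * ?y powr s" using h by (simp add: divide_le_eq)
qed

lemma Lambda_norm_le_if_holder_bound:
  assumes "holder_bound s B f"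
  shows "Lambda_norm s f \<le> ennreal (2 * B)"
proof -
  have B: "0 \<le> B" by (rule holder_bound_nonneg[OF assms])
  have "sup_norm f \<le> ennreal B"
    unfolding sup_norm_def using assms by (intro SUP_least ennreal_leI) (auto simp: holder_bound_def)
  moreover have "(SUP x. SUP y\<in>{0<..1}. Delta_sup (nat \<lfloor>s\<rfloor> + 1) f x y / ennreal (y powr s)) \<le> ennreal B"
  proof (intro SUP_least)
    fix x and y :: real assume y: "y \<in> {0<..1}"
    have "Delta_sup (nat \<lfloor>s\<rfloor> + 1) f x y \<le> ennreal (B * y powr s)"
      unfolding Delta_sup_def diff_order_def[symmetric] using assms y
      by (intro SUP_least ennreal_leI) (auto simp: holder_bound_def)
    then have "Delta_sup (nat \<lfloor>s\<rfloor> + 1) f x y / ennreal (y powr s) \<le> ennreal (B * y powr s) / ennreal (y powr s)"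
      by (rule divide_right_mono_ennreal)
    also have "\<dots> = ennreal B" using y B by (subst divide_ennreal) auto
    finally show "Delta_sup (nat \<lfloor>s\<rfloor> + 1) f x y / ennreal (y powr s) \<le> ennreal B" .
  qed
  ultimately have "Lambda_norm s f \<le> ennreal B + ennreal B"
    unfolding Lambda_norm_def by (rule add_mono)
  then show ?thesis using B by (simp flip: ennreal_plus)
qed

lemma Lambda_holder_bound:
  assumes "f \<in> Lambda s"
  obtains B where "holder_bound s B f"
proof -
  have "Lambda_norm s f < \<infinity>" using assms by (simp add: Lambda_def)
  then obtain B where "Lambda_norm s f = ennreal B" "0 \<le> B" by (cases "Lambda_norm s f") auto
  then show thesis using that Lambda_norm_le_imp_holder_bound[of s f B] by simp
qed

lemma Lambda_if_holder_bound:
  assumes "continuous_on UNIV f" "holder_bound s B f"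
  shows "f \<in> Lambda s"
proof -
  have "bounded (range f)" using assms(2) by (auto simp: bounded_iff holder_bound_def)
  moreover have "Lambda_norm s f < \<infinity>"
    using order_le_less_trans[OF Lambda_norm_le_if_holder_bound[OF assms(2)]] by simp
  ultimately show ?thesis using assms(1) by (simp add: Lambda_def)
qed

lemma holder_bound_diff:
  assumes "holder_bound s B f" "holder_bound s D g"
  shows "holder_bound s (B + D) (\<lambda>x. f x - g x)"
  using assms unfolding holder_bound_def diffk_diff distrib_right
  by (auto intro!: order_trans[OF abs_triangle_ineq4] add_mono)

lemma diffk_zero_step: "diffk (Suc k) 0 f x = 0"
  by (simp add: diffk_Suc)

text \<open>The norm only sees steps up to length 1, while the kernel averages over steps of any
  length within its support. For \<open>norm h > 1\<close> the sup bound is enough, since then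
  \<open>norm h powr s \<ge> 1\<close>.\<close>

lemma holder_bound_diffk:
  assumes "holder_bound s B f" "0 < s"
  shows "\<bar>diffk (diff_order s) h f x\<bar> \<le> 2 ^ diff_order s * B * norm h powr s"
proof -
  have B: "0 \<le> B" by (rule holder_bound_nonneg[OF assms(1)])
  consider "h = 0" | "0 < norm h" "norm h \<le> 1" | "1 < norm h" by force
  then show ?thesis
  proof cases
    case 1
    then show ?thesis by (simp add: diff_order_def diffk_zero_step)
  next
    case 2
    then have "\<bar>diffk (diff_order s) h f x\<bar> \<le> B * norm h powr s" using assms(1) by (simp add: holder_bound_def)
    also have "\<dots> \<le> 2 ^ diff_order s * B * norm h powr s"
      using B by (intro mult_right_mono) (auto simp: mult_le_cancel_right1)
    finally show ?thesis .
  next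
    case 3
    have "\<bar>diffk (diff_order s) h f x\<bar> \<le> 2 ^ diff_order s * B"
      using assms(1) by (intro diffk_bound_sup) (simp add: holder_bound_def)
    moreover have "2 ^ diff_order s * B * 1 \<le> 2 ^ diff_order s * B * norm h powr s"
      using B 3 ge_one_powr_ge_zero[of "norm h" s] assms(2) by (intro mult_left_mono) auto
    ultimately show ?thesis by linarith
  qed
qed

lemma holder_bound_bounded_borel:
  "continuous_on UNIV f \<Longrightarrow> holder_bound s B f \<Longrightarrow> bounded_borel B f"
  by (simp add: bounded_borel_def holder_bound_def borel_measurable_continuous_onI)

section \<open>Dyadic cubes and the sequences indexed by them\<close>

definition cube_index :: "nat \<Rightarrow> real^'n \<Rightarrow> int^'n" where
  "cube_index j x = (\<chi> i. \<lfloor>2 ^ j * x $ i\<rfloor>)"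

text \<open>Half-open cubes of one level partition the space. This collapses every sum over cubes,
  evaluated at \<open>x\<close>, to the single label \<open>cube_index j x\<close>.\<close>

lemma mem_dcube_iff: "x \<in> dcube j k \<longleftrightarrow> k = cube_index j x"
proof -
  have "(real_of_int (k $ i) / 2 ^ j \<le> x $ i \<and> x $ i < (real_of_int (k $ i) + 1) / 2 ^ j)
      \<longleftrightarrow> k $ i = \<lfloor>2 ^ j * x $ i\<rfloor>" for i
    by (simp add: divide_le_eq less_divide_eq eq_commute[of "k $ i"] floor_eq_iff mult.commute)
  then show ?thesis by (simp add: dcube_def cube_index_def vec_eq_iff)
qed

lemma dcube_borel [measurable]: "dcube j (k :: int^'n) \<in> sets borel"
proof -
  have "{x::real^'n. real_of_int (k $ i) / 2 ^ j \<le> x $ i \<and> x $ i < (real_of_int (k $ i) + 1) / 2 ^ j} \<in> sets borel" for i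
    by measurable
  then have "(\<Inter>i\<in>UNIV. {x::real^'n. real_of_int (k $ i) / 2 ^ j \<le> x $ i \<and>
      x $ i < (real_of_int (k $ i) + 1) / 2 ^ j}) \<in> sets borel"
    by (intro sets.finite_INT) auto
  also have "(\<Inter>i\<in>UNIV. {x::real^'n. real_of_int (k $ i) / 2 ^ j \<le> x $ i \<and>
      x $ i < (real_of_int (k $ i) + 1) / 2 ^ j}) = dcube j k"
    by (auto simp: dcube_def)
  finally show ?thesis .
qed

lemma cube_index_measurable: "cube_index j \<in> measurable borel (count_space UNIV)"
proof (subst measurable_count_space_eq2_countable, intro conjI ballI)
  fix k :: "int^'n"
  have "cube_index j -` {k} \<inter> space borel = dcube j k" by (auto simp: mem_dcube_iff)
  then show "cube_index j -` {k} \<inter> space borel \<in> sets borel" by simp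
qed auto

text \<open>Factoring through the countable set of labels makes every choice of \<open>F\<close>
  measurable.\<close>

lemma adm_seq_cube_index: "adm_seq (\<lambda>j x. F j (cube_index j x))"
  unfolding adm_seq_def
proof
  fix j
  have "(\<lambda>x. F j (cube_index j x)) \<in> borel_measurable borel"
    by (rule measurable_compose[OF cube_index_measurable]) simp
  then show "(\<lambda>x. F j (cube_index j x)) \<in> borel_measurable lebesgue"
    by (simp add: measurable_completion)
qed

text \<open>The half-open cube lies between an open and a closed box of equal measure.\<close>

lemma cube_vol_eq: "cube_vol j (k :: int^'n) = 2 powr (- (real j * real CARD('n)))"
proof -
  let ?a = "(\<chi> i. real_of_int (k $ i) / 2 ^ j) :: real^'n" and ?b = "(\<chi> i. (real_of_int (k $ i) + 1) / 2 ^ j) :: real^'n"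
  have ab: "?a $ i \<le> ?b $ i" for i by (simp add: divide_right_mono)
  have sub: "box ?a ?b \<subseteq> dcube j k" "dcube j k \<subseteq> cbox ?a ?b"
    by (auto simp: dcube_def mem_box_cart less_imp_le)
  have "?a \<bullet> b \<le> ?b \<bullet> b" if "b \<in> Basis" for b
    using that ab by (auto simp: Basis_vec_def inner_axis)
  then have "emeasure lborel (box ?a ?b) = emeasure lborel (cbox ?a ?b)"
    by (simp add: emeasure_lborel_box emeasure_lborel_cbox)
  moreover have "emeasure lborel (box ?a ?b) \<le> emeasure lborel (dcube j k)"
    "emeasure lborel (dcube j k) \<le> emeasure lborel (cbox ?a ?b)"
    using sub by (auto intro!: emeasure_mono)
  ultimately have "cube_vol j k = measure lborel (cbox ?a ?b)"
    by (simp add: cube_vol_def measure_def)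
  also have "\<dots> = (\<Prod>i\<in>(UNIV::'n set). 1 / 2 ^ j)"
    using ab by (subst content_cbox_cart) (auto simp: interval_ne_empty_cart diff_divide_distrib[symmetric])
  also have "\<dots> = 2 powr (- (real j * real CARD('n)))"
    by (simp add: powr_minus power_one_over inverse_eq_divide powr_powr flip: powr_realpow)
  finally show ?thesis .
qed

lemma cube_vol_powr:
  "cube_vol j (k :: int^'n) powr (s / real CARD('n) + 1/2)
    = (2 powr (-s)) ^ j / 2 powr (real j * real CARD('n) / 2)"
  "cube_vol j (k :: int^'n) powr (- s / real CARD('n) - 1/2)
    = 2 powr (real j * real CARD('n) / 2) / (2 powr (-s)) ^ j"
proof -
  have e: "(2 powr (-s)) ^ j = 2 powr (- (s * real j))" by (simp add: powr_powr flip: powr_realpow)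
  have "- (real j * real CARD('n)) * (s / real CARD('n) + 1/2) = - (s * real j) - real j * real CARD('n) / 2"
    by (simp add: field_simps)
  then show "cube_vol j k powr (s / real CARD('n) + 1/2) = (2 powr (-s)) ^ j / 2 powr (real j * real CARD('n) / 2)"
    unfolding cube_vol_eq powr_powr e by (simp only: powr_diff)
  have "- (real j * real CARD('n)) * (- s / real CARD('n) - 1/2) = real j * real CARD('n) / 2 - (- (s * real j))"
    by (simp add: field_simps)
  then show "cube_vol j k powr (- s / real CARD('n) - 1/2) = 2 powr (real j * real CARD('n) / 2) / (2 powr (-s)) ^ j"
    unfolding cube_vol_eq powr_powr e by (simp only: powr_diff)
qed

lemma Omega_fiber: "{\<omega>\<in>Omega. fst (snd \<omega>) = j \<and> snd (snd \<omega>) = (k :: int^'n)}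
    = (\<lambda>l. (l, j, k)) ` gen_ind CARD('n) j"
  by (auto simp: Omega_iff image_iff)

text \<open>This is \<open>|I|^(-s/n-1/2)\<close> times the absolute coefficient. In this
  normalisation analysis gives a uniform bound, and \<open>W0\<close> collects the cubes where some
  type exceeds \<open>\<epsilon>\<close>.\<close>

definition ncoef :: "real \<Rightarrow> (real^'n \<Rightarrow> real) \<Rightarrow> (nat \<Rightarrow> real^'n \<Rightarrow> real) \<Rightarrow> (real^'n \<Rightarrow> real)
    \<Rightarrow> nat \<Rightarrow> nat \<Rightarrow> int^'n \<Rightarrow> real" where
  "ncoef s \<phi> \<psi> f l j k = 2 powr (real j * real CARD('n) / 2) / (2 powr (-s)) ^ j * \<bar>coef \<phi> \<psi> f (l, j, k)\<bar>"

lemma ncoef_nonneg: "0 \<le> ncoef s \<phi> \<psi> f l j k"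
  by (simp add: ncoef_def)

lemma ncoef_le_iff: "ncoef s \<phi> \<psi> f l j (k :: int^'n) \<le> c \<longleftrightarrow>
    2 powr (real j * real CARD('n) / 2) * \<bar>coef \<phi> \<psi> f (l, j, k)\<bar> \<le> c * (2 powr (-s)) ^ j"
  by (simp add: ncoef_def divide_le_eq)

lemma wseq_eq:
  "wseq s \<phi> \<psi> f j (x :: real^'n) = (\<Sum>l\<in>gen_ind CARD('n) j. ncoef s \<phi> \<psi> f l j (cube_index j x))"
proof -
  let ?k = "cube_index j x"
  let ?F = "\<lambda>\<omega>. cube_vol j (snd (snd \<omega>)) powr (- s / real CARD('n) - 1/2) * \<bar>coef \<phi> \<psi> f \<omega>\<bar>
      * indicator (dcube j (snd (snd \<omega>))) x :: real"
  have "wseq s \<phi> \<psi> f j x = infsum ?F ((\<lambda>l. (l, j, ?k)) ` gen_ind CARD('n) j)"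
    unfolding wseq_def Omega_fiber[symmetric]
    by (rule infsum_cong_neutral) (auto simp: indicator_def mem_dcube_iff)
  also have "\<dots> = (\<Sum>l\<in>gen_ind CARD('n) j. ?F (l, j, ?k))"
    by (subst infsum_finite, simp, subst sum.reindex) (auto simp: inj_on_def)
  also have "\<dots> = (\<Sum>l\<in>gen_ind CARD('n) j. ncoef s \<phi> \<psi> f l j ?k)"
    unfolding snd_conv cube_vol_powr(2) ncoef_def by (simp add: mem_dcube_iff)
  finally show ?thesis .
qed

lemma W0_iff: "k \<in> W0 \<phi> \<psi> s f \<epsilon> j \<longleftrightarrow> (\<exists>l\<in>gen_ind CARD('n) j. \<epsilon> < ncoef s \<phi> \<psi> f l j (k :: int^'n))"
proof -
  let ?S = "(\<lambda>l. \<bar>coef \<phi> \<psi> f (l, j, k)\<bar>) ` gen_ind CARD('n) j"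
  have "{\<bar>coef \<phi> \<psi> f \<omega>\<bar> |\<omega>. \<omega> \<in> Omega \<and> fst (snd \<omega>) = j \<and> snd (snd \<omega>) = k} = ?S"
    by (auto simp: Omega_iff image_iff)
  moreover have "?S \<noteq> {}" using one_in_gen_ind[of "CARD('n)" j] by auto
  ultimately have "k \<in> W0 \<phi> \<psi> s f \<epsilon> j \<longleftrightarrow>
      (\<exists>l\<in>gen_ind CARD('n) j. \<epsilon> * cube_vol j k powr (s / real CARD('n) + 1/2) < \<bar>coef \<phi> \<psi> f (l, j, k)\<bar>)"
    by (simp add: W0_def Max_gr_iff)
  then show ?thesis unfolding cube_vol_powr(1) ncoef_def by (simp add: field_simps)
qed

lemma W0_seq_eq: "W0_seq \<phi> \<psi> s f \<epsilon> j x = (if cube_index j x \<in> W0 \<phi> \<psi> s f \<epsilon> j then 1 else 0)"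
proof -
  have "W0_seq \<phi> \<psi> s f \<epsilon> j x = infsum (\<lambda>k. indicator (dcube j k) x) (W0 \<phi> \<psi> s f \<epsilon> j \<inter> {cube_index j x})"
    unfolding W0_seq_def by (rule infsum_cong_neutral) (auto simp: indicator_def mem_dcube_iff)
  then show ?thesis by (auto simp: mem_dcube_iff)
qed

lemma adm_seq_wseq: "adm_seq (wseq s \<phi> \<psi> f)"
  using adm_seq_cube_index[of "\<lambda>j k. \<Sum>l\<in>gen_ind CARD('a) j. ncoef s \<phi> \<psi> f l j k"]
  by (simp add: wseq_eq[abs_def])

lemma adm_seq_W0_seq: "adm_seq (W0_seq \<phi> \<psi> s f \<epsilon>)"
  using adm_seq_cube_index[of "\<lambda>j k. if k \<in> W0 \<phi> \<psi> s f \<epsilon> j then 1 else 0"]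
  by (simp add: W0_seq_eq[abs_def])

text \<open>Serves to compare \<open>wseq\<close> and \<open>W0_seq\<close> in both directions; only
  finiteness is transferred, so the size of \<open>c\<close> is irrelevant.\<close>

lemma qn_lattice_finite_if_dominated:
  assumes "qn_lattice X" "adm_seq F" "adm_seq G" "X G < \<infinity>"
    and "\<And>j x. \<bar>F j x\<bar> \<le> c * \<bar>G j x\<bar>" and "0 \<le> c"
  shows "X F < \<infinity>"
proof -
  have "adm_seq (\<lambda>j x. c * G j x)" using assms(3) by (auto simp: adm_seq_def intro!: borel_measurable_times)
  moreover have "\<forall>j. AE x in lebesgue. \<bar>F j x\<bar> \<le> \<bar>c * G j x\<bar>" using assms(5,6) by (simp add: abs_mult)
  ultimately have "X F \<le> X (\<lambda>j x. c * G j x)" using assms(1,2) unfolding qn_lattice_def by blast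
  also have "\<dots> = ennreal \<bar>c\<bar> * X G" using assms(1,3) unfolding qn_lattice_def by blast
  also have "\<dots> < \<infinity>" using assms(4) by (simp add: ennreal_mult_less_top)
  finally show ?thesis .
qed

section \<open>Uniform bounds for normalised coefficients\<close>

context wavelet_system
begin

lemma coef_diff:
  assumes "bounded_borel B f" "bounded_borel D g" "\<omega> \<in> Omega"
  shows "coef \<phi> \<psi> (\<lambda>x. f x - g x) \<omega> = coef \<phi> \<psi> f \<omega> - coef \<phi> \<psi> g \<omega>"
  unfolding coef_def left_diff_distrib
  by (intro Bochner_Integration.integral_diff integral_bounded_mult(1)[OF assms(1)]
      integral_bounded_mult(1)[OF assms(2)] wav_integrable[OF assms(3)])

text \<open>The substitution is \<open>x = 2^-j (k + z)\<close>. Its Jacobian \<open>2^(-jn)\<close>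
  cancels two factors \<open>2^(jn/2)\<close>: the one inside the wavelet and the one placed in
  front.\<close>

lemma coef_rescale:
  assumes f: "bounded_borel B f" and \<omega>: "(l, j, k) \<in> Omega"
  shows "2 powr (real j * real CARD('n) / 2) * coef \<phi> \<psi> f (l, j, k)
    = (LINT z|lborel. f ((1/2) ^ j *\<^sub>R ivec k + (1/2) ^ j *\<^sub>R z) * gen \<phi> \<psi> l z)"
proof -
  let ?c = "(1/2::real) ^ j" and ?a = "2 powr (real j * real CARD('n) / 2)"
  have [measurable]: "f \<in> borel_measurable borel" "wav \<phi> \<psi> (l, j, k) \<in> borel_measurable borel"
    using f borel_measurable_continuous_onI[OF wav_continuous[OF \<omega>]] by auto
  have "2 ^ j *\<^sub>R (?c *\<^sub>R ivec k + ?c *\<^sub>R z) - ivec k = z" for z :: "real^'n"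
    by (simp add: scaleR_add_right power_one_over)
  then have w: "wav \<phi> \<psi> (l, j, k) (?c *\<^sub>R ivec k + ?c *\<^sub>R z) = ?a * gen \<phi> \<psi> l z" for z
    by (simp add: wav_eq[OF \<omega>])
  have "coef \<phi> \<psi> f (l, j, k) = \<bar>?c\<bar> ^ CARD('n) * (LINT z|lborel.
      f (?c *\<^sub>R ivec k + ?c *\<^sub>R z) * wav \<phi> \<psi> (l, j, k) (?c *\<^sub>R ivec k + ?c *\<^sub>R z))"
    unfolding coef_def by (subst lborel_integral_affine[where c = ?c and t = "?c *\<^sub>R ivec k"]) auto
  also have "\<dots> = \<bar>?c\<bar> ^ CARD('n) * (?a * (LINT z|lborel. f (?c *\<^sub>R ivec k + ?c *\<^sub>R z) * gen \<phi> \<psi> l z))"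
    unfolding w by (subst integral_mult_right_zero[symmetric]) (simp only: mult.left_commute)
  finally have "?a * coef \<phi> \<psi> f (l, j, k)
      = (?a * ?a * \<bar>?c\<bar> ^ CARD('n)) * (LINT z|lborel. f (?c *\<^sub>R ivec k + ?c *\<^sub>R z) * gen \<phi> \<psi> l z)"
    by (simp only: mult_ac)
  moreover have "?a * ?a = 2 ^ (j * CARD('n))" by (simp flip: powr_add powr_realpow)
  then have "?a * ?a * \<bar>?c\<bar> ^ CARD('n) = 1"
    by (simp add: power_one_over flip: power_mult)
  ultimately show ?thesis by simp
qed

text \<open>Integral 1 is the normalisation of the scaling function in L^2, read off from
  orthonormality at the index \<open>(0, 0, 0)\<close>; smoothness and support pass to the
  square.\<close>

lemma squared_scaling_function_kernel:
  "smoothing_kernel (\<lambda>x. gen \<phi> \<psi> 0 x * gen \<phi> \<psi> 0 x) R m"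
proof
  show "Ck m (\<lambda>x. gen \<phi> \<psi> 0 x * gen \<phi> \<psi> 0 x)" by (intro Ck_mult gen_Ck) auto
  show "gen \<phi> \<psi> 0 x * gen \<phi> \<psi> 0 x = 0" if "R < norm x" for x using gen_support[OF _ that] by simp
  have 0: "(0, 0, 0 :: int^'n) \<in> Omega" by (simp add: Omega_def)
  have "wav \<phi> \<psi> (0, 0, 0) x = gen \<phi> \<psi> 0 x" for x
    using wav_eq[OF 0, of \<phi> \<psi> x] by (simp add: ivec_def zero_vec_def[symmetric])
  then show "(LINT x|lborel. gen \<phi> \<psi> 0 x * gen \<phi> \<psi> 0 x) = 1" using orthonormal[OF 0 0] by simp
qed (rule radius_nonneg)

lemma ncoef_bound:
  assumes s: "0 < s" and m: "m = diff_order s"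
  obtains C where "0 \<le> C" "\<And>f B l j k. continuous_on UNIV f \<Longrightarrow> holder_bound s B f \<Longrightarrow>
    l \<in> gen_ind CARD('n) j \<Longrightarrow> ncoef s \<phi> \<psi> f l j k \<le> C * B"
proof -
  interpret smoothing_kernel "\<lambda>x. gen \<phi> \<psi> 0 x * gen \<phi> \<psi> 0 x" R m
    by (rule squared_scaling_function_kernel)
  have sm: "s < real m" using diff_order_gt[OF s] m by simp
  define Q where "Q l C \<longleftrightarrow> (\<forall>B f a j. bounded_borel B f \<longrightarrow> (\<forall>h x. \<bar>diffk m h f x\<bar> \<le> B * norm h powr s) \<longrightarrow>
      \<bar>LINT z|lborel. f (a + (1/2) ^ j *\<^sub>R z) * gen \<phi> \<psi> l z\<bar> \<le> C * B * (2 powr (-s)) ^ j)" for l C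
  have "\<exists>C. 0 \<le> C \<and> (1 \<le> l \<longrightarrow> l \<le> 2 ^ CARD('n) - 1 \<longrightarrow> Q l C)" for l
  proof (cases "1 \<le> l \<and> l \<le> 2 ^ CARD('n) - 1")
    case True
    then have l: "1 \<le> l" "l \<le> 2 ^ CARD('n) - 1" by auto
    show ?thesis
      unfolding Q_def
      by (rule coefficient_decay[OF gen_continuous[OF l(2)] gen_support[OF l(2)] gen_moments[OF l]
            radius_nonneg order_le s sm], assumption) blast
  qed auto
  then obtain Cl where Cl: "\<And>l. 0 \<le> Cl l" and Q: "\<And>l. 1 \<le> l \<Longrightarrow> l \<le> 2 ^ CARD('n) - 1 \<Longrightarrow> Q l (Cl l)"
    by metis
  define C0 where "C0 = (LINT z|lborel. \<bar>gen \<phi> \<psi> 0 z\<bar>)"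
  \<comment> \<open>\<open>C0\<close> handles the scaling function, where level 0 demands no decay.
    The factor \<open>2 ^ m\<close> comes from extending the difference bound to all steps.\<close>
  define C where "C = C0 + (\<Sum>l\<le>2 ^ CARD('n) - 1. Cl l) * 2 ^ m"
  have C0: "0 \<le> C0" "0 \<le> (\<Sum>l\<le>2 ^ CARD('n) - 1. Cl l)" using Cl by (auto simp: C0_def sum_nonneg)
  have "ncoef s \<phi> \<psi> f l j k \<le> C * B"
    if f: "continuous_on UNIV f" "holder_bound s B f" and l: "l \<in> gen_ind CARD('n) j" for f B l j k
  proof -
    have \<omega>: "(l, j, k) \<in> Omega" using l by (simp add: Omega_iff)
    have B: "0 \<le> B" by (rule holder_bound_nonneg[OF f(2)])
    have bb: "bounded_borel B f" by (rule holder_bound_bounded_borel[OF f])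
    let ?I = "LINT z|lborel. f ((1/2) ^ j *\<^sub>R ivec k + (1/2) ^ j *\<^sub>R z) * gen \<phi> \<psi> l z"
    have "\<bar>?I\<bar> \<le> C * B * (2 powr (-s)) ^ j"
    proof (cases "l = 0")
      case True
      then have j: "j = 0" using l by (simp add: gen_ind_def split: if_splits)
      have "\<bar>?I\<bar> \<le> B * C0"
        unfolding C0_def True
        by (rule integral_bounded_mult(2)[OF bounded_borel_affine[OF bb]])
          (rule integrable_compact_support[OF gen_continuous gen_support], auto)
      also have "\<dots> \<le> C * B" using B C0 by (simp add: C_def algebra_simps)
      finally show ?thesis by (simp add: j)
    next
      case False
      then have l1: "1 \<le> l" "l \<le> 2 ^ CARD('n) - 1" using gen_ind_le[OF l] by auto
      \<comment> \<open>\<open>coefficient_decay\<close> takes one constant for the sup and the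
        differences, so the sup bound is weakened to match.\<close>
      have "bounded_borel (2 ^ m * B) f"
        using bb B unfolding bounded_borel_def
        by (auto intro: order_trans simp: mult_le_cancel_right1)
      then have "\<bar>?I\<bar> \<le> Cl l * (2 ^ m * B) * (2 powr (-s)) ^ j"
        using Q[OF l1] holder_bound_diffk[OF f(2) s] unfolding Q_def m by blast
      also have "\<dots> \<le> C * B * (2 powr (-s)) ^ j"
      proof (rule mult_right_mono)
        have "Cl l \<le> (\<Sum>l\<le>2 ^ CARD('n) - 1. Cl l)" using l1 Cl by (intro member_le_sum) auto
        then have "Cl l * 2 ^ m \<le> C" using C0 by (simp add: C_def add_increasing)
        then have "Cl l * 2 ^ m * B \<le> C * B" using B by (rule mult_right_mono)
        then show "Cl l * (2 ^ m * B) \<le> C * B" by (simp add: mult.assoc)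
      qed simp
      finally show ?thesis .
    qed
    then show ?thesis
      unfolding ncoef_le_iff coef_rescale[OF bb \<omega>, symmetric] by (simp add: abs_mult)
  qed
  moreover have "0 \<le> C" using C0 by (simp add: C_def)
  ultimately show thesis using that by blast
qed

end

section \<open>A common support radius for the generators\<close>

lemma daubechies_wavelet_system:
  fixes \<phi> :: "real^'n \<Rightarrow> real"
  assumes "daubechies L \<phi> \<psi>" "m \<le> L"
  obtains R where "wavelet_system \<phi> \<psi> m L R"
proof -
  have Ckc: "Ck_c L (gen \<phi> \<psi> l)" if "l \<le> 2 ^ CARD('n) - 1" for l
    using assms(1) that by (auto simp: daubechies_def gen_def)
  have "\<exists>r. \<forall>x. r < norm x \<longrightarrow> gen \<phi> \<psi> l x = 0" if l: "l \<le> 2 ^ CARD('n) - 1" for l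
  proof -
    have "bounded {x. gen \<phi> \<psi> l x \<noteq> 0}"
      using Ckc[OF l] unfolding Ck_c_def by (meson bounded_subset closure_subset compact_imp_bounded)
    then show ?thesis unfolding bounded_iff by (metis (mono_tags) leD mem_Collect_eq)
  qed
  then obtain r where r: "\<And>l x. l \<le> 2 ^ CARD('n) - 1 \<Longrightarrow> r l < norm x \<Longrightarrow> gen \<phi> \<psi> l x = 0" by metis
  define R where "R = (\<Sum>l\<le>2 ^ CARD('n) - 1. \<bar>r l\<bar>)"
  have rR: "r l \<le> R" if "l \<le> 2 ^ CARD('n) - 1" for l
  proof -
    have "\<bar>r l\<bar> \<le> R" unfolding R_def using that by (intro member_le_sum) auto
    then show ?thesis by linarith
  qed
  have "wavelet_system \<phi> \<psi> m L R"
  proof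
    show "Ck m (gen \<phi> \<psi> l)" if "l \<le> 2 ^ CARD('n) - 1" for l
      using Ckc[OF that] Ck_antimono[OF assms(2)] unfolding Ck_c_def by blast
    show "gen \<phi> \<psi> l x = 0" if "l \<le> 2 ^ CARD('n) - 1" "R < norm x" for l x
      using r[OF that(1)] rR[OF that(1)] that(2) by auto
    show "vanishing_moments L (gen \<phi> \<psi> l)" if "1 \<le> l" "l \<le> 2 ^ CARD('n) - 1" for l
      using assms(1) that by (auto simp: daubechies_def gen_def vanishing_moments_def)
    show "(LINT x|lborel. wav \<phi> \<psi> \<omega> x * wav \<phi> \<psi> \<omega>' x) = (if \<omega> = \<omega>' then 1 else 0)"
      if "\<omega> \<in> Omega" "\<omega>' \<in> Omega" for \<omega> \<omega>'
      using assms(1) that unfolding daubechies_def by blast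
    show "0 \<le> R" by (simp add: R_def sum_nonneg)
  qed (rule assms(2))
  then show thesis by (rule that)
qed

section \<open>Two-sided estimate of the distance\<close>

theorem mainTheorem3:
  fixes X :: "(nat \<Rightarrow> real^'n \<Rightarrow> real) \<Rightarrow> ennreal"
    and s :: real and L :: nat
    and \<phi> :: "real^'n \<Rightarrow> real" and \<psi> :: "nat \<Rightarrow> real^'n \<Rightarrow> real"
  assumes "qn_lattice X" and "0 < s"
    and "daubechies L \<phi> \<psi>" and "s < real L"
  shows "\<exists>c C. 0 < c \<and> 0 < C \<and>
           (\<forall>f\<in>Lambda s.
              ennreal c * eps_crit X s \<phi> \<psi> f \<le> dist_Lambda s f (Lambda_X X s \<phi> \<psi>) \<and>
              dist_Lambda s f (Lambda_X X s \<phi> \<psi>) \<le> ennreal C * eps_crit X s \<phi> \<psi> f)"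
proof -
  define m where "m = diff_order s"
  have mL: "m \<le> L" and sm: "s < real m"
    using diff_order_le[OF assms(4,2)] diff_order_gt[OF assms(2)] by (auto simp: m_def)
  obtain R where "wavelet_system \<phi> \<psi> m L R" by (rule daubechies_wavelet_system[OF assms(3) mL])
  then interpret wavelet_system \<phi> \<psi> m L R .
  obtain A0 where A0: "0 \<le> A0" "\<And>f B l j k. continuous_on UNIV f \<Longrightarrow> holder_bound s B f \<Longrightarrow>
    l \<in> gen_ind CARD('n) j \<Longrightarrow> ncoef s \<phi> \<psi> f l j k \<le> A0 * B"
    by (rule ncoef_bound[OF assms(2) m_def], rule that)
  \<comment> \<open>Adding 1 ensures positivity, so that \<open>1 / A\<close> can serve as the lower
    constant.\<close>
  define A where "A = A0 + 1"
  have A: "0 < A" using A0(1) by (simp add: A_def)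
  have anal: "ncoef s \<phi> \<psi> f l j k \<le> A * B"
    if "continuous_on UNIV f" "holder_bound s B f" "l \<in> gen_ind CARD('n) j" for f B l j k
    using A0(2)[OF that, of k] holder_bound_nonneg[OF that(2)] unfolding A_def by (simp add: distrib_right)
  obtain S where S: "0 \<le> S" "\<And>c \<epsilon>. 0 \<le> \<epsilon> \<Longrightarrow>
    (\<forall>l j k. (l, j, k) \<in> Omega \<longrightarrow> 2 powr (real j * real CARD('n) / 2) * \<bar>c (l, j, k)\<bar> \<le> \<epsilon> * (2 powr (-s)) ^ j) \<Longrightarrow>
    \<exists>h. continuous_on UNIV h \<and> (\<forall>x. \<bar>h x\<bar> \<le> S * \<epsilon>) \<and>
      (\<forall>v x. 0 < norm v \<longrightarrow> norm v \<le> 1 \<longrightarrow> \<bar>diffk m v h x\<bar> \<le> S * \<epsilon> * norm v powr s) \<and>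
      (\<forall>\<omega>\<in>Omega. coef \<phi> \<psi> h \<omega> = c \<omega>)"
    by (rule synthesis[OF assms(2) sm], rule that)
  have Lam: "continuous_on UNIV f" "\<exists>B. holder_bound s B f \<and> bounded_borel B f" if "f \<in> Lambda s" for f :: "real^'n \<Rightarrow> real"
  proof -
    show c: "continuous_on UNIV f" using that by (simp add: Lambda_def)
    show "\<exists>B. holder_bound s B f \<and> bounded_borel B f"
      using Lambda_holder_bound[OF that] holder_bound_bounded_borel[OF c] by blast
  qed
  have lower: "ennreal (1 / A) * eps_crit X s \<phi> \<psi> f \<le> dist_Lambda s f (Lambda_X X s \<phi> \<psi>)"
    if f: "f \<in> Lambda s" for f
    unfolding dist_Lambda_def
  proof (rule INF_greatest)
    fix g assume g: "g \<in> Lambda_X X s \<phi> \<psi> \<inter> Lambda s"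
    let ?d = "\<lambda>x. f x - g x"
    have Xg: "X (wseq s \<phi> \<psi> g) < \<infinity>" using g by (simp add: Lambda_X_def)
    show "ennreal (1 / A) * eps_crit X s \<phi> \<psi> f \<le> Lambda_norm s ?d"
    proof (cases "Lambda_norm s ?d")
      case (real B)
      have hd: "holder_bound s B ?d" by (rule Lambda_norm_le_imp_holder_bound) (use real in auto)
      have cd: "continuous_on UNIV ?d" using Lam(1) f g by (intro continuous_on_diff) auto
      obtain Bf Bg where bb: "bounded_borel Bf f" "bounded_borel Bg g" using Lam(2) f g by blast
      \<comment> \<open>The slack \<open>e\<close> is what remains for \<open>g\<close>: a
        coefficient of \<open>f\<close> above \<open>A * B + e\<close>, minus one of
        \<open>f - g\<close> of at most \<open>A * B\<close>, leaves at least \<open>e\<close>. It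
        also keeps the threshold positive when \<open>B = 0\<close>.\<close>
      have eps: "eps_crit X s \<phi> \<psi> f \<le> ennreal (A * B) + ennreal e" if e: "0 < e" for e
      proof -
        define \<epsilon> where "\<epsilon> = A * B + e"
        have \<epsilon>: "0 < \<epsilon>" using A real e by (simp add: \<epsilon>_def add_nonneg_pos)
        have "X (W0_seq \<phi> \<psi> s f \<epsilon>) < \<infinity>"
        proof (rule qn_lattice_finite_if_dominated[OF assms(1) adm_seq_W0_seq adm_seq_wseq Xg])
          show "\<bar>W0_seq \<phi> \<psi> s f \<epsilon> j x\<bar> \<le> (1 / e) * \<bar>wseq s \<phi> \<psi> g j x\<bar>" for j x
          proof (cases "cube_index j x \<in> W0 \<phi> \<psi> s f \<epsilon> j")
            case True
            let ?k = "cube_index j x"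
            obtain l where l: "l \<in> gen_ind CARD('n) j" and gt: "\<epsilon> < ncoef s \<phi> \<psi> f l j ?k"
              using True by (auto simp: W0_iff)
            then have \<omega>: "(l, j, ?k) \<in> Omega" by (simp add: Omega_iff)
            have "\<bar>coef \<phi> \<psi> f (l, j, ?k)\<bar> \<le> \<bar>coef \<phi> \<psi> ?d (l, j, ?k)\<bar> + \<bar>coef \<phi> \<psi> g (l, j, ?k)\<bar>"
              using coef_diff[OF bb \<omega>] by linarith
            then have "ncoef s \<phi> \<psi> f l j ?k \<le> ncoef s \<phi> \<psi> ?d l j ?k + ncoef s \<phi> \<psi> g l j ?k"
              unfolding ncoef_def distrib_left[symmetric] by (rule mult_left_mono) simp
            then have "e \<le> ncoef s \<phi> \<psi> g l j ?k"
              using gt anal[OF cd hd l, of ?k] by (simp add: \<epsilon>_def)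
            also have "\<dots> \<le> wseq s \<phi> \<psi> g j x"
              unfolding wseq_eq by (rule member_le_sum[OF l]) (auto simp: ncoef_nonneg)
            finally show ?thesis using True e by (simp add: W0_seq_eq le_divide_eq)
          qed (use e in \<open>simp add: W0_seq_eq\<close>)
        qed (use e in simp)
        then have "eps_crit X s \<phi> \<psi> f \<le> ennreal \<epsilon>"
          unfolding eps_crit_def using \<epsilon> by (intro Inf_lower) blast
        then show ?thesis using A real e by (simp add: \<epsilon>_def ennreal_plus)
      qed
      have "eps_crit X s \<phi> \<psi> f \<le> ennreal (A * B)" by (rule ennreal_le_epsilon) (rule eps)
      then have "ennreal (1 / A) * eps_crit X s \<phi> \<psi> f \<le> ennreal (1 / A) * ennreal (A * B)"
        by (rule mult_left_mono) simp
      also have "\<dots> = ennreal B" using A real by (simp flip: ennreal_mult)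
      finally show ?thesis using real by simp
    qed simp
  qed
  \<comment> \<open>The 2 is the passage from \<open>holder_bound\<close> to the norm; the 1 secures
    positivity.\<close>
  define C where "C = 2 * S + 1"
  have C: "0 < C" using S(1) by (simp add: C_def)
  have upper: "dist_Lambda s f (Lambda_X X s \<phi> \<psi>) \<le> ennreal C * eps_crit X s \<phi> \<psi> f"
    if f: "f \<in> Lambda s" for f
  proof -
    let ?D = "dist_Lambda s f (Lambda_X X s \<phi> \<psi>)"
    obtain B where B: "holder_bound s B f" "bounded_borel B f" using Lam(2)[OF f] by blast
    have D: "?D \<le> ennreal C * ennreal \<epsilon>" if \<epsilon>: "0 < \<epsilon>" and X: "X (W0_seq \<phi> \<psi> s f \<epsilon>) < \<infinity>" for \<epsilon>
    proof -
      define c where "c \<omega> = (case \<omega> of (l, j, k) \<Rightarrow> if k \<in> W0 \<phi> \<psi> s f \<epsilon> j then 0 else coef \<phi> \<psi> f (l, j, k))" for \<omega>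
      have "\<forall>l j k. (l, j, k) \<in> Omega \<longrightarrow>
          2 powr (real j * real CARD('n) / 2) * \<bar>c (l, j, k)\<bar> \<le> \<epsilon> * (2 powr (-s)) ^ j"
      proof (intro allI impI)
        fix l j k assume "(l, j, k :: int^'n) \<in> Omega"
        then have l: "l \<in> gen_ind CARD('n) j" by (simp add: Omega_iff)
        show "2 powr (real j * real CARD('n) / 2) * \<bar>c (l, j, k)\<bar> \<le> \<epsilon> * (2 powr (-s)) ^ j"
        proof (cases "k \<in> W0 \<phi> \<psi> s f \<epsilon> j")
          case False
          then have "ncoef s \<phi> \<psi> f l j k \<le> \<epsilon>" using l by (auto simp: W0_iff not_less)
          then show ?thesis using False by (simp add: ncoef_le_iff c_def)
        qed (use \<epsilon> in \<open>simp add: c_def\<close>)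
      qed
      from S(2)[OF less_imp_le[OF \<epsilon>] this] obtain h where
        ch: "continuous_on UNIV h" and "\<forall>x. \<bar>h x\<bar> \<le> S * \<epsilon>"
          "\<forall>v x. 0 < norm v \<longrightarrow> norm v \<le> 1 \<longrightarrow> \<bar>diffk m v h x\<bar> \<le> S * \<epsilon> * norm v powr s"
        and coef_h: "\<And>\<omega>. \<omega> \<in> Omega \<Longrightarrow> coef \<phi> \<psi> h \<omega> = c \<omega>" by blast
      then have hh: "holder_bound s (S * \<epsilon>) h" by (simp add: holder_bound_def m_def)
      have bh: "bounded_borel (S * \<epsilon>) h" by (rule holder_bound_bounded_borel[OF ch hh])
      define g where "g x = f x - h x" for x
      have g: "g \<in> Lambda s"
        unfolding g_def[abs_def]
        by (rule Lambda_if_holder_bound[OF continuous_on_diff[OF Lam(1)[OF f] ch] holder_bound_diff[OF B(1) hh]])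
      have coef_g: "coef \<phi> \<psi> g (l, j, k) = (if k \<in> W0 \<phi> \<psi> s f \<epsilon> j then coef \<phi> \<psi> f (l, j, k) else 0)"
        if "l \<in> gen_ind CARD('n) j" for l j k
        using that coef_diff[OF B(2) bh, of "(l, j, k)"] coef_h[of "(l, j, k)"]
        unfolding g_def[abs_def] by (simp add: Omega_iff c_def)
      have B0: "0 \<le> B" by (rule holder_bound_nonneg[OF B(1)])
      have "X (wseq s \<phi> \<psi> g) < \<infinity>"
      proof (rule qn_lattice_finite_if_dominated[OF assms(1) adm_seq_wseq adm_seq_W0_seq X])
        \<comment> \<open>On a selected cube there are at most \<open>2 ^ n\<close> types, each with
          normalised coefficient at most \<open>A * B\<close>; elsewhere all coefficients of
          \<open>g\<close> vanish.\<close>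
        show "\<bar>wseq s \<phi> \<psi> g j x\<bar> \<le> (2 ^ CARD('n) * (A * B)) * \<bar>W0_seq \<phi> \<psi> s f \<epsilon> j x\<bar>" for j x
        proof (cases "cube_index j x \<in> W0 \<phi> \<psi> s f \<epsilon> j")
          case True
          have "ncoef s \<phi> \<psi> g l j (cube_index j x) \<le> A * B" if "l \<in> gen_ind CARD('n) j" for l
            using anal[OF Lam(1)[OF f] B(1) that, of "cube_index j x"] coef_g[OF that] True by (simp add: ncoef_def)
          then have "wseq s \<phi> \<psi> g j x \<le> real (card (gen_ind CARD('n) j)) * (A * B)"
            unfolding wseq_eq by (rule sum_bounded_above)
          also have "\<dots> \<le> 2 ^ CARD('n) * (A * B)"
          proof (rule mult_right_mono)
            have "real (card (gen_ind CARD('n) j)) \<le> real (2 ^ CARD('n))"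
              by (rule of_nat_mono[OF card_gen_ind])
            then show "real (card (gen_ind CARD('n) j)) \<le> 2 ^ CARD('n)" by simp
          qed (use A B0 in simp)
          finally show ?thesis
            using True by (simp add: W0_seq_eq wseq_eq ncoef_nonneg sum_nonneg)
        next
          case False
          then show ?thesis using coef_g by (simp add: W0_seq_eq wseq_eq ncoef_def)
        qed
      qed (use A B0 in simp)
      then have gX: "g \<in> Lambda_X X s \<phi> \<psi> \<inter> Lambda s" using g by (simp add: Lambda_X_def)
      have "?D \<le> Lambda_norm s (\<lambda>x. f x - g x)"
        unfolding dist_Lambda_def by (rule INF_lower[OF gX])
      also have "\<dots> = Lambda_norm s h" by (simp add: g_def)
      also have "\<dots> \<le> ennreal (2 * (S * \<epsilon>))" by (rule Lambda_norm_le_if_holder_bound[OF hh])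
      also have "\<dots> \<le> ennreal (C * \<epsilon>)" using \<epsilon> by (intro ennreal_leI) (simp add: C_def distrib_right)
      also have "\<dots> = ennreal C * ennreal \<epsilon>" using C \<epsilon> by (simp add: ennreal_mult)
      finally show ?thesis .
    qed
    have inv: "ennreal (1 / C) * ennreal C = 1" using C by (simp flip: ennreal_mult)
    \<comment> \<open>With the constant on the left, the bound can be checked against each
      admissible \<open>\<epsilon>\<close> separately. If there is none, the infimum is infinite and
      nothing remains to check.\<close>
    have "ennreal (1 / C) * ?D \<le> eps_crit X s \<phi> \<psi> f"
      unfolding eps_crit_def
    proof (rule Inf_greatest, clarify)
      fix \<epsilon> :: real assume "0 < \<epsilon>" "X (W0_seq \<phi> \<psi> s f \<epsilon>) < \<infinity>"
      from mult_left_mono[OF D[OF this], of "ennreal (1 / C)"]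
      show "ennreal (1 / C) * ?D \<le> ennreal \<epsilon>" by (simp add: inv flip: mult.assoc)
    qed
    from mult_left_mono[OF this, of "ennreal C"] show ?thesis
      using inv by (simp add: mult.commute[of "ennreal C" "ennreal (1 / C)"] flip: mult.assoc)
  qed
  show ?thesis
    using lower upper A C by (intro exI[of _ "1 / A"] exI[of _ C]) auto
qed

end
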